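(* Let $R$ be a short rate process from the class $\mathbb{A}_g(a,b;\alpha_1,\dots,\alpha_g;\eta_1,\dots,\eta_g)$ with $R(0)=r_0\ge0$. If $p\in(0,\alpha_g)$ then $\mathbb{E}(R(t))^p<+\infty$ for every $t\in(0,+\infty)$. Moreover, for $p\in(1,\alpha_g)$, $$\mathbb{E}(R(t))^p\le e^{apt}I_p(t),$$ where $I_p$ is a nonnegative function satisfying the ordinary differential equation $$\frac{dI_p(t)}{dt}=e^{-at}(c(p-1)+b)\,p\,(I_p(t))^{(p-1)/p}+\sum_{i=l}^{g}e^{a(1-\alpha_i)t}h_{\alpha_i}(I_p(t))^{(p+1-\alpha_i)/p},\qquad I_p(0)=r_0^p,$$ with $h_{\alpha_i}=\frac{p(p-1)}{\Gamma(2-p)}\Gamma(\alpha_i-p)\,\eta_i$, $i=l,\dots,g$, where $l=2$, $c=\eta_1$ in the case $\alpha_1=2$, while $l=1$, $c=0$ in the case $\alpha_1<2$.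
   Context: Parameters: $g\ge1$, $a\in\mathbb{R}$, $b\ge0$, $2\ge\alpha_1>\alpha_2>\dots>\alpha_g>1$, $\eta_1,\dots,\eta_g>0$. Put $c_2=\frac12$, $c_\alpha=\frac{\Gamma(2-\alpha)}{\alpha(\alpha-1)}$ for $\alpha\in(1,2)$, and $d_i=\eta_i/c_{\alpha_i}$. The class $\mathbb{A}_g(a,b;\alpha_1,\dots,\alpha_g;\eta_1,\dots,\eta_g)$ consists of the nonnegative Markov processes with generator $$\mathcal{A}f(x)=cxf''(x)+(ax+b)f'(x)+x\int_{(0,+\infty)}\{f(x+v)-f(x)-f'(x)v\}\,\mu(dv),\qquad \mu(dv)=\sum_{i=l}^g\frac{d_i}{v^{1+\alpha_i}}dv,\ v>0,$$ where $c=\eta_1$, $l=2$ if $\alpha_1=2$, and $c=0$, $l=1$ otherwise. Equivalently, $R$ has the same generator as the unique strong nonnegative solution of the canonical equation $$dR(t)=(aR(t-)+b)\,dt+\sum_{i=1}^gd_i^{1/\alpha_i}R(t-)^{1/\alpha_i}\,dZ^{\alpha_i}(t),\qquad R(0)=r_0\ge 0,$$ where $Z^{\alpha_1},\dots,Z^{\alpha_g}$ are independent canonical stable martingales: $Z^2$ is a standard Brownian motion, and for $\alpha\in(1,2)$, $Z^\alpha$ is the real Lévy martingale with no Wiener part and Lévy measure $v^{-\alpha-1}\mathbf{1}_{\{v>0\}}dv$. *)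

theory Defs
  imports "HOL-Probability.Probability"
begin

section \<open>Nonnegative time-homogeneous Markov processes and their generators\<close>

abbreviation half_line :: "real measure" where
  "half_line \<equiv> restrict_space borel {0..}"

definition natural_filtration :: "'w measure \<Rightarrow> (real \<Rightarrow> 'w \<Rightarrow> real) \<Rightarrow> real \<Rightarrow> 'w measure" where
  "natural_filtration M R s =
     sigma (space M) (\<Union>u\<in>{0..s}. {R u -` B \<inter> space M | B. B \<in> sets borel})"

text \<open>Only times \<open>t \<ge> 0\<close> and starting points \<open>x \<ge> 0\<close> matter. The kernels are probability
  kernels, so the semigroup is conservative.\<close>

definition transition_semigroup :: "(real \<Rightarrow> real \<Rightarrow> real measure) \<Rightarrow> bool" where
  "transition_semigroup P \<longleftrightarrow>
     (\<forall>t\<ge>0. P t \<in> half_line \<rightarrow>\<^sub>M prob_algebra half_line) \<and>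
     (\<forall>x\<ge>0. P 0 x = return half_line x) \<and>
     (\<forall>s\<ge>0. \<forall>t\<ge>0. \<forall>x\<ge>0. P (s + t) x = P s x \<bind> P t)"

definition nonneg_markov_process ::
    "'w measure \<Rightarrow> (real \<Rightarrow> 'w \<Rightarrow> real) \<Rightarrow> (real \<Rightarrow> real \<Rightarrow> real measure) \<Rightarrow> bool" where
  "nonneg_markov_process M R P \<longleftrightarrow>
     prob_space M \<and>
     transition_semigroup P \<and>
     (\<forall>t\<ge>0. R t \<in> M \<rightarrow>\<^sub>M half_line) \<and>
     (\<forall>s\<ge>0. \<forall>t\<ge>0. \<forall>B\<in>sets half_line.
        AE \<omega> in M. real_cond_exp M (natural_filtration M R s)
                      (\<lambda>\<omega>. indicator B (R (s + t) \<omega>)) \<omega> = measure (P t (R s \<omega>)) B)"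

text \<open>The infinitesimal generator is taken in the supremum norm over the state space
  \<open>[0, \<infinity>)\<close>; \<open>has_generator_on D P A\<close> says that \<open>D\<close> is contained in its domain and that it acts
  as \<open>A\<close> there.\<close>

definition has_generator_on ::
    "(real \<Rightarrow> real) set \<Rightarrow> (real \<Rightarrow> real \<Rightarrow> real measure) \<Rightarrow> ((real \<Rightarrow> real) \<Rightarrow> real \<Rightarrow> real) \<Rightarrow> bool"
where
  "has_generator_on D P A \<longleftrightarrow>
     (\<forall>f\<in>D. uniform_limit {0..} (\<lambda>h x. ((\<integral>y. f y \<partial>P h x) - f x) / h) (A f) (at_right 0))"

text \<open>\<open>C\<^sub>c\<^sup>2([0, \<infinity>))\<close>: a function on \<open>[0, \<infinity>)\<close> that is \<open>C\<^sup>2\<close> up to the boundary is represented by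
  any \<open>C\<^sup>2\<close> extension to the real line. Its values on the negative axis play no role, so only
  vanishing near \<open>+\<infinity>\<close> is required.\<close>

definition C2c_half_line :: "(real \<Rightarrow> real) set" where
  "C2c_half_line =
     {f. (\<forall>x. f differentiable (at x)) \<and> (\<forall>x. deriv f differentiable (at x)) \<and>
         continuous_on UNIV (deriv (deriv f)) \<and> (\<exists>K. \<forall>x\<ge>K. f x = 0)}"

text \<open>The usual domain on which the generator of a conservative affine (CBI) process is given:
  \<open>C\<^sub>c\<^sup>2([0, \<infinity>))\<close> together with the linear hull of the decaying exponentials. Since generators
  are linear, listing the exponentials themselves is enough.\<close>

definition affine_test_functions :: "(real \<Rightarrow> real) set" where
  "affine_test_functions = C2c_half_line \<union> {(\<lambda>x. exp (- q * x)) | q. q > 0}"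


section \<open>The class of affine short rates driven by stable martingales\<close>

text \<open>The families \<open>\<alpha>\<close> and \<open>\<eta>\<close> are indexed by \<open>1, \<dots>, g\<close>.\<close>

definition stable_const :: "real \<Rightarrow> real" where
  "stable_const \<alpha> = (if \<alpha> = 2 then 1 / 2 else Gamma (2 - \<alpha>) / (\<alpha> * (\<alpha> - 1)))"

definition first_jump_index :: "(nat \<Rightarrow> real) \<Rightarrow> nat" where
  "first_jump_index \<alpha> = (if \<alpha> 1 = 2 then 2 else 1)"

definition diffusion_coeff :: "(nat \<Rightarrow> real) \<Rightarrow> (nat \<Rightarrow> real) \<Rightarrow> real" where
  "diffusion_coeff \<alpha> \<eta> = (if \<alpha> 1 = 2 then \<eta> 1 else 0)"

definition jump_measure :: "nat \<Rightarrow> (nat \<Rightarrow> real) \<Rightarrow> (nat \<Rightarrow> real) \<Rightarrow> real measure" where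
  "jump_measure g \<alpha> \<eta> =
     density lborel (\<lambda>v. ennreal (indicator {0<..} v *
       (\<Sum>i = first_jump_index \<alpha>..g. (\<eta> i / stable_const (\<alpha> i)) / v powr (1 + \<alpha> i))))"

definition affine_generator ::
    "nat \<Rightarrow> real \<Rightarrow> real \<Rightarrow> (nat \<Rightarrow> real) \<Rightarrow> (nat \<Rightarrow> real) \<Rightarrow> (real \<Rightarrow> real) \<Rightarrow> real \<Rightarrow> real"
where
  "affine_generator g a b \<alpha> \<eta> f x =
     diffusion_coeff \<alpha> \<eta> * x * deriv (deriv f) x + (a * x + b) * deriv f x
     + x * (\<integral>v. (f (x + v) - f x - deriv f x * v) \<partial>jump_measure g \<alpha> \<eta>)"

definition class_A ::
    "nat \<Rightarrow> real \<Rightarrow> real \<Rightarrow> (nat \<Rightarrow> real) \<Rightarrow> (nat \<Rightarrow> real) \<Rightarrow>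
     'w measure \<Rightarrow> (real \<Rightarrow> 'w \<Rightarrow> real) \<Rightarrow> bool"
where
  "class_A g a b \<alpha> \<eta> M R \<longleftrightarrow>
     (\<exists>P. nonneg_markov_process M R P \<and>
          has_generator_on affine_test_functions P (affine_generator g a b \<alpha> \<eta>))"

text \<open>Right-hand side, at time \<open>t\<close> and state \<open>y\<close>, of the differential equation for the moment
  bound.\<close>

definition moment_ode_rhs ::
    "nat \<Rightarrow> real \<Rightarrow> real \<Rightarrow> (nat \<Rightarrow> real) \<Rightarrow> (nat \<Rightarrow> real) \<Rightarrow> real \<Rightarrow> real \<Rightarrow> real \<Rightarrow> real"
where
  "moment_ode_rhs g a b \<alpha> \<eta> p t y =
     exp (- a * t) * (diffusion_coeff \<alpha> \<eta> * (p - 1) + b) * p * y powr ((p - 1) / p)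
     + (\<Sum>i = first_jump_index \<alpha>..g.
          exp (a * (1 - \<alpha> i) * t)
          * (p * (p - 1) / Gamma (2 - p) * Gamma (\<alpha> i - p) * \<eta> i)
          * y powr ((p + 1 - \<alpha> i) / p))"

end

(* The exponentials exp(-q x) are the only test functions needed. Discounting to X(t) = exp(-a t) R(t)
   removes the linear drift, and the generator turns into a closed evolution equation for the Laplace
   transform E exp(-q X(t)) with nonnegative coefficients. Letting q tend to 0 bounds E X(t). Writing
     x^p = p (p - 1) / Gamma (2 - p) * int_0^oo (exp(-q x) - 1 + q x) q^(-1-p) dq
   and integrating the Laplace equation against q^(-1-p) by Tonelli bounds E X(t)^p by r0^p plus the
   time integral of moments of the orders p - 1 and p + 1 - alpha_i, and the constants that appear are
   exactly those of the differential equation. As these orders are below p, Jensen's inequality turns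
   this into an integral inequality n(t) <= r0^p + int_0^t F(s, n(s)) ds for a majorant n of E X(t)^p,
   with F increasing in its second argument, and monotone iteration from n produces a solution I of
   the differential equation above n. *)

theory Submission
  imports Defs
begin

section \<open>Gamma integrals\<close>

text \<open>The function x^p is not a test function, and no path regularity is assumed that would
  support stopping times, so neither a direct nor a localised Dynkin formula applies to it. Since p
  > 1, the weight q^(-1-p) is not integrable at 0 against a quantity of order q, hence the
  subtraction of the linear term; as this term enters with a positive sign, an upper bound for the
  mean is enough. A diffusion part is the case alpha_1 = 2 of the jump formula, because c q^2 =
  eta_1 q^alpha_1. The orders p - 1 and p + 1 - alpha_i lie strictly between 0 and 1, so the mean
  makes the right-hand side finite before the p-th moment is known to be finite. The differential
  equation is not Lipschitz at 0: for r0 = 0 the zero function solves it, although the moments are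
  positive in general. An arbitrary solution therefore cannot be compared with the moments, and one
  above them has to be constructed.\<close>

lemma nn_integral_Gamma_scaled:
  assumes s: "s > 0" and x: "x > (0::real)"
  shows "(\<integral>\<^sup>+q\<in>{0<..}. ennreal (q powr (s - 1) * exp (- q * x)) \<partial>lborel) = ennreal (Gamma s * x powr (- s))"
proof -
  let ?J = "\<integral>\<^sup>+q\<in>{0<..}. ennreal (q powr (s - 1) * exp (- q * x)) \<partial>lborel"
  have "ennreal (Gamma s) = (\<integral>\<^sup>+t. ennreal (indicator {0..} t * t powr (s - 1) / exp t) \<partial>lborel)"
    by (rule Gamma_conv_nn_integral_real[OF s])
  also have "\<dots> = ennreal x * (\<integral>\<^sup>+q. ennreal (indicator {0..} (0 + x * q) * (0 + x * q) powr (s - 1) / exp (0 + x * q)) \<partial>lborel)"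
    using x by (subst nn_integral_real_affine[where c = x and t = 0]) auto
  also have "(\<integral>\<^sup>+q. ennreal (indicator {0..} (0 + x * q) * (0 + x * q) powr (s - 1) / exp (0 + x * q)) \<partial>lborel)
    = (\<integral>\<^sup>+q. ennreal (x powr (s - 1)) * (ennreal (q powr (s - 1) * exp (- q * x)) * indicator {0<..} q) \<partial>lborel)"
  proof (intro nn_integral_cong)
    fix q :: real
    show "ennreal (indicator {0..} (0 + x * q) * (0 + x * q) powr (s - 1) / exp (0 + x * q))
      = ennreal (x powr (s - 1)) * (ennreal (q powr (s - 1) * exp (- q * x)) * indicator {0<..} q)"
    proof (cases "q > 0")
      case True
      then show ?thesis using x
        by (simp add: ennreal_mult'[symmetric] powr_mult exp_minus field_simps)
    next
      case False
      then show ?thesis using x by (cases "q = 0") (auto simp: zero_le_mult_iff indicator_def)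
    qed
  qed
  also have "\<dots> = ennreal (x powr (s - 1)) * ?J"
    by (subst nn_integral_cmult) auto
  finally have "ennreal (Gamma s) = ennreal (x powr s) * ?J"
    using x by (simp add: mult.assoc[symmetric] ennreal_mult'[symmetric] powr_diff)
  then have "ennreal (x powr (- s)) * ennreal (Gamma s) = ennreal (x powr (- s) * x powr s) * ?J"
    by (simp add: ennreal_mult' mult.assoc)
  then show ?thesis
    using x s by (simp add: ennreal_mult'[symmetric] powr_add[symmetric] mult.commute)
qed

lemma nn_integral_powr_Icc:
  assumes "s > 0" "x \<ge> (0::real)"
  shows "(\<integral>\<^sup>+y\<in>{0..x}. ennreal (y powr (s - 1)) \<partial>lborel) = ennreal (x powr s / s)"
proof -
  have "((\<lambda>y. y powr (s - 1)) has_integral (x powr (s - 1 + 1) / (s - 1 + 1))) {0..x}"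
    using assms by (intro has_integral_powr_from_0) auto
  from nn_integral_has_integral_lebesgue[OF _ this] show ?thesis
    by (simp add: nn_integral_set_ennreal mult.commute[of "_ powr _"])
qed

text \<open>Since 1 - exp (-q x) is the integral of q exp (-q y) over y in [0, x], Tonelli leaves a
  Gamma integral in q with exponent 2 - p, positive because p < 2, and then the power y^(p-2),
  integrable at 0 because p > 1.\<close>

lemma nn_integral_one_minus_exp_powr:
  assumes p: "1 < p" "p < 2" and x: "x \<ge> (0::real)"
  shows "(\<integral>\<^sup>+q\<in>{0<..}. ennreal ((1 - exp (- q * x)) * q powr (- p)) \<partial>lborel)
    = ennreal (Gamma (2 - p) / (p - 1) * x powr (p - 1))"
proof -
  have "(\<integral>\<^sup>+q\<in>{0<..}. ennreal ((1 - exp (- q * x)) * q powr (- p)) \<partial>lborel)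
    = (\<integral>\<^sup>+q. \<integral>\<^sup>+y. ennreal (q powr ((2 - p) - 1) * exp (- q * y)) * indicator {0<..} q * indicator {0..x} y \<partial>lborel \<partial>lborel)"
  proof (intro nn_integral_cong)
    fix q :: real
    show "ennreal ((1 - exp (- q * x)) * q powr (- p)) * indicator {0<..} q
      = (\<integral>\<^sup>+y. ennreal (q powr ((2 - p) - 1) * exp (- q * y)) * indicator {0<..} q * indicator {0..x} y \<partial>lborel)"
    proof (cases "q > 0")
      case True
      have "(\<integral>\<^sup>+y. ennreal (q powr ((2 - p) - 1) * exp (- q * y)) * indicator {0..x} y \<partial>lborel)
        = ennreal (- (q powr (- p) * exp (- q * x)) - - (q powr (- p) * exp (- q * 0)))"
        using True x
        by (intro nn_integral_FTC_Icc)
          (auto intro!: derivative_eq_intros simp: powr_diff powr_minus field_simps)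
      then show ?thesis using True by (simp add: algebra_simps)
    qed auto
  qed
  also have "\<dots> = (\<integral>\<^sup>+y. \<integral>\<^sup>+q. ennreal (q powr ((2 - p) - 1) * exp (- q * y)) * indicator {0<..} q * indicator {0..x} y \<partial>lborel \<partial>lborel)"
    by (rule lborel_pair.Fubini') measurable
  also have "\<dots> = (\<integral>\<^sup>+y. ennreal (Gamma (2 - p)) * (ennreal (y powr ((p - 1) - 1)) * indicator {0..x} y) \<partial>lborel)"
  \<comment> \<open>At y = 0 the inner integral is infinite, while
    \<open>y powr ((p - 1) - 1)\<close> evaluates to 0; this null set has to be taken out.\<close>
  proof (rule nn_integral_cong_AE, rule AE_mp[OF AE_lborel_singleton[of 0]], intro AE_I2 impI)
    fix y :: real assume y: "y \<noteq> 0"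
    show "(\<integral>\<^sup>+q. ennreal (q powr ((2 - p) - 1) * exp (- q * y)) * indicator {0<..} q * indicator {0..x} y \<partial>lborel)
      = ennreal (Gamma (2 - p)) * (ennreal (y powr ((p - 1) - 1)) * indicator {0..x} y)"
    proof (cases "y \<in> {0..x}")
      case True
      then have "y > 0" using y by auto
      from nn_integral_Gamma_scaled[OF _ this, of "2 - p"] True p show ?thesis
        by (simp add: ennreal_mult')
    qed auto
  qed
  also have "\<dots> = ennreal (Gamma (2 - p)) * ennreal (x powr (p - 1) / (p - 1))"
    using nn_integral_powr_Icc[of "p - 1" x] p x by (subst nn_integral_cmult) auto
  finally show ?thesis
    using p by (simp add: ennreal_mult'[symmetric])
qed

text \<open>One integration more: exp (-q x) - 1 + q x is the integral of q (1 - exp (-q y)) over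
  [0, x], so Tonelli reduces to the preceding integral. It serves twice: with p the order of a
  moment, and with p = alpha_i in the generator, where the integration variable is the jump
  size.\<close>

lemma nn_integral_exp_remainder_powr:
  assumes p: "1 < p" "p < 2" and x: "x \<ge> (0::real)"
  shows "(\<integral>\<^sup>+q\<in>{0<..}. ennreal ((exp (- q * x) - 1 + q * x) * q powr (- 1 - p)) \<partial>lborel)
    = ennreal (Gamma (2 - p) / (p * (p - 1)) * x powr p)"
proof -
  have "(\<integral>\<^sup>+q\<in>{0<..}. ennreal ((exp (- q * x) - 1 + q * x) * q powr (- 1 - p)) \<partial>lborel)
    = (\<integral>\<^sup>+q. \<integral>\<^sup>+y. ennreal ((1 - exp (- q * y)) * q powr (- p)) * indicator {0<..} q * indicator {0..x} y \<partial>lborel \<partial>lborel)"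
  proof (intro nn_integral_cong)
    fix q :: real
    show "ennreal ((exp (- q * x) - 1 + q * x) * q powr (- 1 - p)) * indicator {0<..} q
      = (\<integral>\<^sup>+y. ennreal ((1 - exp (- q * y)) * q powr (- p)) * indicator {0<..} q * indicator {0..x} y \<partial>lborel)"
    proof (cases "q > 0")
      case True
      have "(\<integral>\<^sup>+y. ennreal ((1 - exp (- q * y)) * q powr (- p)) * indicator {0..x} y \<partial>lborel)
        = ennreal ((exp (- q * x) + q * x) * q powr (- 1 - p) - (exp (- q * 0) + q * 0) * q powr (- 1 - p))"
        using True x
        by (intro nn_integral_FTC_Icc)
          (auto intro!: derivative_eq_intros simp: powr_diff powr_minus field_simps)
      then show ?thesis using True by (simp add: algebra_simps)
    qed auto
  qed
  also have "\<dots> = (\<integral>\<^sup>+y. \<integral>\<^sup>+q. ennreal ((1 - exp (- q * y)) * q powr (- p)) * indicator {0<..} q * indicator {0..x} y \<partial>lborel \<partial>lborel)"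
    by (rule lborel_pair.Fubini') measurable
  also have "\<dots> = (\<integral>\<^sup>+y. ennreal (Gamma (2 - p) / (p - 1)) * (ennreal (y powr (p - 1)) * indicator {0..x} y) \<partial>lborel)"
  proof (rule nn_integral_cong)
    fix y :: real
    show "(\<integral>\<^sup>+q. ennreal ((1 - exp (- q * y)) * q powr (- p)) * indicator {0<..} q * indicator {0..x} y \<partial>lborel)
      = ennreal (Gamma (2 - p) / (p - 1)) * (ennreal (y powr (p - 1)) * indicator {0..x} y)"
    proof (cases "y \<in> {0..x}")
      case True
      with nn_integral_one_minus_exp_powr[OF p, of y] p show ?thesis
        by (simp add: ennreal_mult'[symmetric])
    qed auto
  qed
  also have "\<dots> = ennreal (Gamma (2 - p) / (p - 1)) * ennreal (x powr p / p)"
    using nn_integral_powr_Icc[of p x] p x by (subst nn_integral_cmult) auto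
  finally show ?thesis
    using p by (simp add: ennreal_mult'[symmetric] mult.commute)
qed

section \<open>Solutions of monotone differential equations above a subsolution\<close>

lemma continuous_on_indefinite_integral:
  fixes f :: "real \<Rightarrow> real"
  assumes f: "\<And>T. T \<ge> 0 \<Longrightarrow> f integrable_on {0..T}"
  shows "continuous_on {0..} (\<lambda>t. c + integral {0..t} f)"
proof -
  have "continuous (at t within {0..}) (\<lambda>t. c + integral {0..t} f)" if t: "t \<ge> 0" for t
  proof -
    \<comment> \<open>The compact interval reaches beyond t, since only then does it agree with the
      half-line near t.\<close>
    have "continuous_on {0..t + 1} (\<lambda>t. c + integral {0..t} f)"
      using t by (intro continuous_intros indefinite_integral_continuous_1 f) auto
    then have "continuous (at t within {0..t + 1}) (\<lambda>t. c + integral {0..t} f)"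
      using t by (auto simp: continuous_on_eq_continuous_within)
    moreover have "at t within {0..t + 1} = at t within {0..}"
      by (rule at_within_nhd[where S = "{t - 1<..<t + 1}"]) auto
    ultimately show ?thesis by (simp add: continuous_within)
  qed
  then show ?thesis by (auto simp: continuous_on_eq_continuous_within)
qed

text \<open>Monotone Picard iteration started from the subsolution; the affine growth bound keeps the
  iterates below one common exponential on each compact interval.\<close>

lemma monotone_ode_solution_above_subsolution:
  fixes F :: "real \<Rightarrow> real \<Rightarrow> real" and n :: "real \<Rightarrow> real"
  assumes cont: "continuous_on ({0..} \<times> {0..}) (\<lambda>(t, y). F t y)"
    and nonneg: "\<And>t y. t \<ge> 0 \<Longrightarrow> y \<ge> 0 \<Longrightarrow> F t y \<ge> 0"
    and mono: "\<And>t x y. t \<ge> 0 \<Longrightarrow> 0 \<le> x \<Longrightarrow> x \<le> y \<Longrightarrow> F t x \<le> F t y"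
    and growth: "\<And>T. \<exists>K. \<forall>t\<in>{0..T}. \<forall>y\<ge>0. F t y \<le> K * (1 + y)"
    and n_cont: "continuous_on {0..} n" and n_nonneg: "\<And>t. t \<ge> 0 \<Longrightarrow> n t \<ge> 0"
    and n_sub: "\<And>t. t \<ge> 0 \<Longrightarrow> n t \<le> A + integral {0..t} (\<lambda>s. F s (n s))"
    and A: "A \<ge> 0"
  obtains I where "I 0 = A" "\<And>t. t \<ge> 0 \<Longrightarrow> n t \<le> I t"
    "\<And>t. t \<ge> 0 \<Longrightarrow> (I has_real_derivative F t (I t)) (at t within {0..})"
proof -
  define J where "J = rec_nat n (\<lambda>k f t. A + integral {0..t} (\<lambda>s. F s (f s)))"
  have J0: "J 0 = n" and JSuc: "J (Suc k) t = A + integral {0..t} (\<lambda>s. F s (J k s))" for k t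
    by (simp_all add: J_def)
  have comp_cont: "continuous_on S (\<lambda>s. F s (f s))"
    if "continuous_on S f" "\<And>s. s \<in> S \<Longrightarrow> 0 \<le> f s" "S \<subseteq> {0..}" for f S
  proof -
    have "continuous_on S (\<lambda>s. (s, f s))" using that by (intro continuous_intros)
    from continuous_on_compose2[OF cont this] that show ?thesis by auto
  qed
  have J_props: "continuous_on {0..} (J k) \<and> (\<forall>t\<ge>0. 0 \<le> J k t \<and> J k t \<le> J (Suc k) t)" for k
  proof (induction k)
    case 0
    show ?case using n_cont n_nonneg n_sub by (simp add: J0 JSuc)
  next
    case (Suc k)
    then have k: "continuous_on {0..} (J k)" "\<And>t. t \<ge> 0 \<Longrightarrow> 0 \<le> J k t"
      "\<And>t. t \<ge> 0 \<Longrightarrow> J k t \<le> J (Suc k) t" by blast+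
    have int: "(\<lambda>s. F s (J k s)) integrable_on {0..T}" for T
      by (intro integrable_continuous_real comp_cont continuous_on_subset[OF k(1)] k(2)) auto
    have c: "continuous_on {0..} (J (Suc k))"
      using continuous_on_indefinite_integral[OF int, of A] by (simp add: JSuc[abs_def])
    have n0: "0 \<le> J (Suc k) t" if "t \<ge> 0" for t
      using k(2,3)[OF that] by (rule order_trans)
    have int': "(\<lambda>s. F s (J (Suc k) s)) integrable_on {0..T}" for T
      by (intro integrable_continuous_real comp_cont continuous_on_subset[OF c] n0) auto
    have "J (Suc k) t \<le> J (Suc (Suc k)) t" if "t \<ge> 0" for t
    proof -
      have "integral {0..t} (\<lambda>s. F s (J k s)) \<le> integral {0..t} (\<lambda>s. F s (J (Suc k) s))"
        by (intro integral_le int int' mono k) auto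
      then show ?thesis by (simp add: JSuc[of "Suc k" t] JSuc[of k t])
    qed
    then show ?case using c n0 by blast
  qed
  have J_cont: "continuous_on {0..} (J k)" for k using J_props by blast
  have J_nonneg: "0 \<le> J k t" if "t \<ge> 0" for k t using J_props that by blast
  have J_mono: "J k t \<le> J (Suc k) t" if "t \<ge> 0" for k t using J_props that by blast
  have J_int: "(\<lambda>s. F s (J k s)) integrable_on {0..T}" if "T \<ge> 0" for T k
    using J_nonneg by (intro integrable_continuous_real comp_cont continuous_on_subset[OF J_cont]) auto
  have J_bounded: "\<exists>B. \<forall>k. \<forall>t\<in>{0..T}. J k t \<le> B" if T: "T \<ge> 0" for T
  proof -
    obtain K0 where K0: "\<forall>t\<in>{0..T}. \<forall>y\<ge>0. F t y \<le> K0 * (1 + y)" using growth by blast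
    define K where "K = max K0 1"
    have K: "K > 0" "F t y \<le> K * (1 + y)" if "t \<in> {0..T}" "y \<ge> 0" for t y
    proof -
      show "K > 0" by (simp add: K_def)
      have "F t y \<le> K0 * (1 + y)" using K0 that by blast
      also have "\<dots> \<le> K * (1 + y)" using that by (intro mult_right_mono) (auto simp: K_def)
      finally show "F t y \<le> K * (1 + y)" .
    qed
    have "compact (n ` {0..T})"
      by (intro compact_continuous_image continuous_on_subset[OF n_cont]) auto
    then obtain N where N: "\<forall>t\<in>{0..T}. n t \<le> N"
      by (metis bounded_imp_bdd_above compact_imp_bounded bdd_above.E image_eqI)
    \<comment> \<open>\<open>C \<ge> 1 + N\<close> starts the induction.
      \<open>C \<ge> 1 + A\<close> carries the step: integrating K C exp (K s) gives back C exp (K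
      t) - C, and the -C pays for 1 + A.\<close>
    define C where "C = 1 + max A N"
    have C: "C \<ge> 1 + A" "C \<ge> 1 + N" "C \<ge> 0" using A by (auto simp: C_def)
    have Kpos: "K > 0" by (simp add: K_def)
    have "\<forall>t\<in>{0..T}. 1 + J k t \<le> C * exp (K * t)" for k
    proof (induction k)
      case 0
      show ?case
      proof
        fix t assume t: "t \<in> {0..T}"
        have "1 + J 0 t \<le> C * 1" using N[rule_format, OF t] C by (simp add: J0)
        also have "\<dots> \<le> C * exp (K * t)" using C t Kpos by (intro mult_left_mono) auto
        finally show "1 + J 0 t \<le> C * exp (K * t)" .
      qed
    next
      case (Suc k)
      show ?case
      proof
        fix t assume t: "t \<in> {0..T}"
        have hi: "((\<lambda>s. K * (C * exp (K * s))) has_integral (C * exp (K * t) - C * exp (K * 0))) {0..t}"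
          using t by (intro fundamental_theorem_of_calculus)
            (auto intro!: derivative_eq_intros simp flip: has_real_derivative_iff_has_vector_derivative)
        have "integral {0..t} (\<lambda>s. F s (J k s)) \<le> integral {0..t} (\<lambda>s. K * (C * exp (K * s)))"
        proof (intro integral_le J_int has_integral_integrable[OF hi])
          show "0 \<le> t" using t by auto
          fix s assume s: "s \<in> {0..t}"
          have "F s (J k s) \<le> K * (1 + J k s)" using s t by (intro K J_nonneg) auto
          also have "\<dots> \<le> K * (C * exp (K * s))"
            using Suc s t Kpos by (intro mult_left_mono) auto
          finally show "F s (J k s) \<le> K * (C * exp (K * s))" .
        qed
        also have "\<dots> = C * exp (K * t) - C" unfolding integral_unique[OF hi] by simp
        finally show "1 + J (Suc k) t \<le> C * exp (K * t)" using C by (simp add: JSuc)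
      qed
    qed
    note bound = this
    have "J k t \<le> C * exp (K * T)" if "t \<in> {0..T}" for k t
    proof -
      have "J k t \<le> C * exp (K * t)" using bound[rule_format, OF that, of k] by linarith
      also have "\<dots> \<le> C * exp (K * T)" using that C Kpos by (intro mult_left_mono) auto
      finally show ?thesis .
    qed
    then show ?thesis by blast
  qed
  define I where "I t = lim (\<lambda>k. J k t)" for t
  have J_lim: "(\<lambda>k. J k t) \<longlonglongrightarrow> I t" if t: "t \<ge> 0" for t
  proof -
    obtain B where "\<And>k. J k t \<le> B" using J_bounded[OF t] t by (meson atLeastAtMost_iff order_refl)
    then have "convergent (\<lambda>k. J k t)"
      by (intro Bseq_monoseq_convergent BseqI'[where K = B] incseq_imp_monoseq)
        (auto simp: J_nonneg t incseq_Suc_iff J_mono)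
    then show ?thesis by (simp add: I_def convergent_LIMSEQ_iff)
  qed
  have J_le_I: "J k t \<le> I t" if "t \<ge> 0" for k t
    using J_lim[OF that] J_mono[OF that] by (intro incseq_le) (auto simp: incseq_Suc_iff)
  have I_nonneg: "I t \<ge> 0" if "t \<ge> 0" for t
    using J_le_I[OF that, of 0] J_nonneg[OF that, of 0] by linarith
  have step: "(\<lambda>s. F s (I s)) integrable_on {0..t} \<and> I t = A + integral {0..t} (\<lambda>s. F s (I s))"
    if t: "t \<ge> 0" for t
  proof -
    have lim: "(\<lambda>k. F s (J k s)) \<longlonglongrightarrow> F s (I s)" if s: "s \<in> {0..t}" for s
    proof -
      have "continuous_on {0..} (F s)"
        using s by (intro continuous_on_compose2[OF cont, of _ "\<lambda>y. (s, y)", simplified]) (auto intro!: continuous_intros)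
      then show ?thesis
        using s J_lim[of s] J_nonneg[of s] I_nonneg[of s]
        by (intro continuous_on_tendsto_compose[where f = "F s" and s = "{0..}"]) auto
    qed
    \<comment> \<open>These integrals are \<open>J (Suc k) t - A\<close>, so the common bound of the
      iterates bounds them too, as monotone convergence requires.\<close>
    have bdd: "bounded (range (\<lambda>k. integral {0..t} (\<lambda>s. F s (J k s))))"
    proof -
      obtain B where B: "\<forall>k. \<forall>s\<in>{0..t}. J k s \<le> B" using J_bounded[OF t] by blast
      have "integral {0..t} (\<lambda>s. F s (J k s)) \<in> {0..B - A}" for k
        using B[rule_format, of t "Suc k"] t
        by (auto simp: JSuc intro!: integral_nonneg J_int nonneg J_nonneg)
      then have "range (\<lambda>k. integral {0..t} (\<lambda>s. F s (J k s))) \<subseteq> {0..B - A}" by blast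
      then show ?thesis by (rule bounded_subset[OF bounded_closed_interval])
    qed
    have mct: "(\<lambda>s. F s (I s)) integrable_on {0..t} \<and>
       (\<lambda>k. integral {0..t} (\<lambda>s. F s (J k s))) \<longlonglongrightarrow> integral {0..t} (\<lambda>s. F s (I s))"
      using t J_mono J_nonneg
      by (intro monotone_convergence_increasing[OF J_int[OF t] _ lim bdd]) (auto intro!: mono)
    have "(\<lambda>k. J (Suc k) t) \<longlonglongrightarrow> A + integral {0..t} (\<lambda>s. F s (I s))"
      unfolding JSuc using mct by (intro tendsto_intros) auto
    with J_lim[OF t] have "I t = A + integral {0..t} (\<lambda>s. F s (I s))"
      using LIMSEQ_unique LIMSEQ_Suc by blast
    with mct show ?thesis by blast
  qed
  \<comment> \<open>So far \<open>I\<close> is only a pointwise limit. The integral equation makes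
    it continuous, hence also the integrand, and the equation can be differentiated at every
    t.\<close>
  have I_cont: "continuous_on {0..} I"
    using continuous_on_indefinite_integral[of "\<lambda>s. F s (I s)" A] step
    by (subst continuous_on_cong[OF refl, of _ _ "\<lambda>t. A + integral {0..t} (\<lambda>s. F s (I s))"]) auto
  show thesis
  proof
    show "I 0 = A" using step[of 0] by simp
    show "n t \<le> I t" if "t \<ge> 0" for t using J_le_I[OF that, of 0] by (simp add: J0)
    show "(I has_real_derivative F t (I t)) (at t within {0..})" if t: "t \<ge> 0" for t
    proof -
      have "continuous_on {0..t + 1} (\<lambda>s. F s (I s))"
        using I_nonneg by (intro comp_cont continuous_on_subset[OF I_cont]) auto
      then have "((\<lambda>t. integral {0..t} (\<lambda>s. F s (I s))) has_real_derivative F t (I t)) (at t within {0..t + 1})"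
        using t by (intro integral_has_real_derivative) auto
      then have "((\<lambda>t. A + integral {0..t} (\<lambda>s. F s (I s))) has_real_derivative F t (I t)) (at t within {0..t + 1})"
        by (auto intro!: derivative_eq_intros)
      moreover have "at t within {0..t + 1} = at t within {0..}"
        by (rule at_within_nhd[where S = "{t - 1<..<t + 1}"]) auto
      ultimately have "((\<lambda>t. A + integral {0..t} (\<lambda>s. F s (I s))) has_real_derivative F t (I t)) (at t within {0..})"
        by simp
      then show ?thesis
        using t step by (elim has_field_derivative_transform_within[where d = 1]) auto
    qed
  qed
qed

section \<open>Markov processes and their generators\<close>

lemma subalgebra_natural_filtration:
  assumes "\<And>u. 0 \<le> u \<Longrightarrow> R u \<in> M \<rightarrow>\<^sub>M half_line"
  shows "subalgebra M (natural_filtration M R s)"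
proof -
  let ?G = "\<Union>u\<in>{0..s}. {R u -` B \<inter> space M | B. B \<in> sets borel}"
  have "R u \<in> borel_measurable M" if "0 \<le> u" for u
    using assms[OF that] by (simp add: measurable_restrict_space2_iff)
  then have "?G \<subseteq> sets M" by (auto intro: measurable_sets)
  moreover from this have "?G \<subseteq> Pow (space M)" using sets.sets_into_space by blast
  ultimately show ?thesis
    by (auto simp: subalgebra_def natural_filtration_def sets.sigma_sets_subset
        simp del: UN_simps dest: subsetD[OF sets.sigma_sets_subset])
qed

text \<open>The Markov property is given for indicators only. Taking expectations in it identifies
  the law of \<open>R (s + t)\<close> with the law of \<open>R s\<close> composed with the kernel
  \<open>P t\<close>; an equality of measures then covers every bounded f at once.\<close>

lemma nonneg_markov_process_integral:
  fixes f :: "real \<Rightarrow> real"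
  assumes mp: "nonneg_markov_process M R P" and s: "s \<ge> 0" and t: "t \<ge> 0"
    and f: "f \<in> borel_measurable half_line" and bdd: "\<And>x. x \<ge> 0 \<Longrightarrow> \<bar>f x\<bar> \<le> B"
  shows "(\<integral>\<omega>. f (R (s + t) \<omega>) \<partial>M) = (\<integral>\<omega>. (\<integral>y. f y \<partial>P t (R s \<omega>)) \<partial>M)"
proof -
  interpret prob_space M using mp by (simp add: nonneg_markov_process_def)
  have R_meas: "R u \<in> M \<rightarrow>\<^sub>M half_line" if "0 \<le> u" for u
    using mp that by (simp add: nonneg_markov_process_def)
  note [measurable] = R_meas[OF s] R_meas[OF add_nonneg_nonneg[OF s t]] f
  have P_meas: "P t \<in> half_line \<rightarrow>\<^sub>M prob_algebra half_line"
    using mp t by (simp add: nonneg_markov_process_def transition_semigroup_def)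
  note [measurable] = measurable_prob_algebraD[OF P_meas]
  interpret F: finite_measure_subalgebra M "natural_filtration M R s"
    by unfold_locales (rule subalgebra_natural_filtration[OF R_meas])
  let ?N = "distr M half_line (R s)"
  interpret N: prob_space ?N by (rule prob_space_distr) measurable
  have P_prob: "prob_space (P t x)" "sets (P t x) = sets half_line" if "x \<ge> 0" for x
    using measurable_space[OF P_meas, of x] that
    by (auto simp: space_prob_algebra space_restrict_space)
  have R_nonneg: "R s \<omega> \<ge> 0" if "\<omega> \<in> space M" for \<omega>
    using measurable_space[OF R_meas[OF s] that] by (simp add: space_restrict_space)
  have law: "distr M half_line (R (s + t)) = ?N \<bind> P t"
  proof (rule measure_eqI)
    show "sets (distr M half_line (R (s + t))) = sets (?N \<bind> P t)"
      by (subst sets_bind[where N = half_line]) (auto simp: P_prob space_restrict_space)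
  next
    fix A assume "A \<in> sets (distr M half_line (R (s + t)))"
    then have A[measurable]: "A \<in> sets half_line" by simp
    have int: "integrable M (\<lambda>\<omega>. indicat_real A (R (s + t) \<omega>))"
      by (intro integrable_const_bound[where B = 1]) auto
    have m: "(\<lambda>\<omega>. measure (P t (R s \<omega>)) A) \<in> borel_measurable M"
      by (rule measurable_compose[OF R_meas[OF s]], rule measurable_compose[OF measurable_prob_algebraD[OF P_meas]])
        measurable
    have AE: "AE \<omega> in M. real_cond_exp M (natural_filtration M R s)
        (\<lambda>\<omega>. indicator A (R (s + t) \<omega>)) \<omega> = measure (P t (R s \<omega>)) A"
      using mp s t A by (simp add: nonneg_markov_process_def)
    have "emeasure (distr M half_line (R (s + t))) A = (\<integral>\<^sup>+x. indicator A x \<partial>distr M half_line (R (s + t)))"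
      by simp
    also have "\<dots> = (\<integral>\<^sup>+\<omega>. ennreal (indicat_real A (R (s + t) \<omega>)) \<partial>M)"
      by (subst nn_integral_distr) (auto simp: ennreal_indicator)
    also have "\<dots> = ennreal (\<integral>\<omega>. indicat_real A (R (s + t) \<omega>) \<partial>M)"
      using int by (intro nn_integral_eq_integral) auto
    also have "(\<integral>\<omega>. indicat_real A (R (s + t) \<omega>) \<partial>M) = (\<integral>\<omega>. measure (P t (R s \<omega>)) A \<partial>M)"
      using F.real_cond_exp_int[OF int] integral_cong_AE[OF _ m AE] by simp
    also have "ennreal \<dots> = (\<integral>\<^sup>+\<omega>. ennreal (measure (P t (R s \<omega>)) A) \<partial>M)"
      using m P_prob R_nonneg
      by (intro nn_integral_eq_integral[symmetric] integrable_const_bound[where B = 1])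
        (auto intro!: prob_space.prob_le_1)
    also have "\<dots> = (\<integral>\<^sup>+\<omega>. emeasure (P t (R s \<omega>)) A \<partial>M)"
      using P_prob R_nonneg
      by (intro nn_integral_cong finite_measure.emeasure_eq_measure[symmetric] prob_space.axioms) auto
    also have "\<dots> = (\<integral>\<^sup>+x. emeasure (P t x) A \<partial>?N)"
      by (subst nn_integral_distr) (auto intro: measurable_emeasure_kernel)
    also have "\<dots> = emeasure (?N \<bind> P t) A"
      by (subst emeasure_bind[where N = half_line]) (auto simp: space_restrict_space)
    finally show "emeasure (distr M half_line (R (s + t))) A = emeasure (?N \<bind> P t) A" .
  qed
  have "(\<integral>\<omega>. f (R (s + t) \<omega>) \<partial>M) = (\<integral>y. f y \<partial>(?N \<bind> P t))"
    unfolding law[symmetric] by (subst integral_distr) auto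
  also have "\<dots> = (\<integral>x. (\<integral>y. f y \<partial>P t x) \<partial>?N)"
    using bdd P_prob
    by (intro integral_bind[where K = half_line and B' = 1 and B = B])
      (auto simp: space_restrict_space prob_space.emeasure_space_1 N.finite_measure_axioms)
  also have "\<dots> = (\<integral>\<omega>. (\<integral>y. f y \<partial>P t (R s \<omega>)) \<partial>M)"
    by (subst integral_distr) auto
  finally show ?thesis .
qed

text \<open>A generator yields forward quotients only. A backward quotient at t is the forward
  quotient at an earlier s, which is close to \<psi> s by uniformity, and \<psi> s is close to
  \<psi> t because \<psi> is continuous as a uniform limit of continuous quotients. The bound on
  \<psi> makes \<phi> locally Lipschitz, which is what makes those quotients continuous.\<close>

lemma has_real_derivative_of_uniform_right_derivative:
  fixes \<phi> \<psi> :: "real \<Rightarrow> real"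
  assumes unif: "uniform_limit {0..} (\<lambda>h t. (\<phi> (t + h) - \<phi> t) / h) \<psi> (at_right 0)"
    and bdd: "\<And>t. t \<ge> 0 \<Longrightarrow> \<bar>\<psi> t\<bar> \<le> B" and t: "t \<ge> 0"
  shows "(\<phi> has_real_derivative \<psi> t) (at t within {0..})"
proof -
  have close: "\<exists>\<delta>>0. \<forall>h. 0 < h \<and> h < \<delta> \<longrightarrow> (\<forall>s\<ge>0. \<bar>(\<phi> (s + h) - \<phi> s) / h - \<psi> s\<bar> < \<epsilon>)"
    if "\<epsilon> > 0" for \<epsilon>
    using uniform_limitD[OF unif that] by (force simp: eventually_at_right_field dist_real_def)
  obtain \<delta> where \<delta>: "\<delta> > 0"
    and lip: "\<And>h s. 0 < h \<Longrightarrow> h < \<delta> \<Longrightarrow> s \<ge> 0 \<Longrightarrow> \<bar>(\<phi> (s + h) - \<phi> s) / h - \<psi> s\<bar> < 1"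
    using close[of 1] by auto
  have B: "B \<ge> 0" using bdd[of 0] by simp
  have lip': "\<bar>\<phi> (s + h) - \<phi> s\<bar> \<le> (B + 1) * h" if "0 < h" "h < \<delta>" "s \<ge> 0" for h s
  proof -
    have "\<bar>(\<phi> (s + h) - \<phi> s) / h\<bar> \<le> B + 1" using lip[OF that] bdd[OF that(3)] by linarith
    then show ?thesis using that(1) by (simp add: abs_divide divide_le_eq)
  qed
  have cont_\<phi>: "continuous_on {0..} \<phi>"
  proof (clarsimp simp: continuous_on_iff dist_real_def)
    fix s \<epsilon> :: real assume s: "0 \<le> s" and \<epsilon>: "0 < \<epsilon>"
    show "\<exists>d>0. \<forall>r\<in>{0..}. \<bar>r - s\<bar> < d \<longrightarrow> \<bar>\<phi> r - \<phi> s\<bar> < \<epsilon>"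
    proof (intro exI[of _ "min \<delta> (\<epsilon> / (B + 1))"] conjI ballI impI)
      show "min \<delta> (\<epsilon> / (B + 1)) > 0" using \<delta> \<epsilon> B by auto
      fix r :: real assume r: "r \<in> {0..}" and d: "\<bar>r - s\<bar> < min \<delta> (\<epsilon> / (B + 1))"
      have "\<bar>\<phi> r - \<phi> s\<bar> \<le> (B + 1) * \<bar>r - s\<bar>"
      proof (cases r s rule: linorder_cases)
        case less
        then show ?thesis using lip'[of "s - r" r] r d by auto
      next
        case greater
        then show ?thesis using lip'[of "r - s" s] s d by auto
      qed auto
      also have "\<dots> < (B + 1) * (\<epsilon> / (B + 1))" using d B by (intro mult_strict_left_mono) auto
      finally show "\<bar>\<phi> r - \<phi> s\<bar> < \<epsilon>" using B by simp
    qed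
  qed
  have "continuous_on {0..} \<psi>"
  proof (rule uniform_limit_theorem[OF _ unif])
    show "\<forall>\<^sub>F h in at_right 0. continuous_on {0..} (\<lambda>t. (\<phi> (t + h) - \<phi> t) / h)"
      using eventually_at_right_less[of 0]
    proof eventually_elim
      case (elim h)
      have "continuous_on {0..} (\<lambda>t. \<phi> (t + h))"
        using elim by (intro continuous_on_compose2[OF cont_\<phi>]) (auto intro!: continuous_intros)
      then show ?case using elim by (intro continuous_intros cont_\<phi>) auto
    qed
  qed auto
  then have cont_\<psi>: "\<exists>d>0. \<forall>s\<ge>0. \<bar>s - t\<bar> < d \<longrightarrow> \<bar>\<psi> s - \<psi> t\<bar> < \<epsilon>" if "\<epsilon> > 0" for \<epsilon>
    using that t unfolding continuous_on_iff dist_real_def by (metis atLeast_iff)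
  show ?thesis
    unfolding has_field_derivative_iff
  proof (rule tendstoI)
    fix \<epsilon> :: real assume \<epsilon>: "\<epsilon> > 0"
    obtain d1 where d1: "d1 > 0" "\<And>h s. 0 < h \<Longrightarrow> h < d1 \<Longrightarrow> s \<ge> 0 \<Longrightarrow> \<bar>(\<phi> (s + h) - \<phi> s) / h - \<psi> s\<bar> < \<epsilon> / 2"
      using close[of "\<epsilon> / 2"] \<epsilon> by auto
    obtain d2 where d2: "d2 > 0" "\<And>s. s \<ge> 0 \<Longrightarrow> \<bar>s - t\<bar> < d2 \<Longrightarrow> \<bar>\<psi> s - \<psi> t\<bar> < \<epsilon> / 2"
      using cont_\<psi>[of "\<epsilon> / 2"] \<epsilon> by auto
    have "dist ((\<phi> s - \<phi> t) / (s - t)) (\<psi> t) < \<epsilon>"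
      if s: "s \<ge> 0" "s \<noteq> t" "dist s t < min d1 d2" for s
    proof (cases "s > t")
      case True
      then show ?thesis using d1(2)[of "s - t" t] s t \<epsilon> by (auto simp: dist_real_def)
    next
      case False
      then have "(\<phi> s - \<phi> t) / (s - t) = (\<phi> (s + (t - s)) - \<phi> s) / (t - s)"
        by (metis add.commute diff_add_cancel minus_diff_eq minus_divide_divide)
      moreover have "\<bar>(\<phi> (s + (t - s)) - \<phi> s) / (t - s) - \<psi> s\<bar> < \<epsilon> / 2" "\<bar>\<psi> s - \<psi> t\<bar> < \<epsilon> / 2"
        using d1(2)[of "t - s" s] d2(2)[of s] s False by (auto simp: dist_real_def)
      ultimately show ?thesis unfolding dist_real_def by linarith
    qed
    then show "\<forall>\<^sub>F s in at t within {0..}. dist ((\<phi> s - \<phi> t) / (s - t)) (\<psi> t) < \<epsilon>"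
      using d1 d2 unfolding eventually_at by (intro exI[of _ "min d1 d2"]) auto
  qed
qed

section \<open>Action of the generator on exponentials and on expectations\<close>

lemma has_bochner_integral_exp_remainder_powr:
  fixes p x :: real
  assumes "1 < p" "p < 2" "x \<ge> 0"
  shows "has_bochner_integral lborel (\<lambda>q. indicator {0<..} q * ((exp (- q * x) - 1 + q * x) * q powr (- 1 - p)))
    (Gamma (2 - p) / (p * (p - 1)) * x powr p)"
proof (rule has_bochner_integral_nn_integral)
  have "exp (- q * x) - 1 + q * x \<ge> 0" for q using exp_ge_add_one_self[of "- q * x"] by simp
  then show "AE q in lborel. 0 \<le> indicator {0<..} q * ((exp (- q * x) - 1 + q * x) * q powr (- 1 - p))"
    by (intro AE_I2) (auto intro!: mult_nonneg_nonneg)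
  show "(\<integral>\<^sup>+q. ennreal (indicator {0<..} q * ((exp (- q * x) - 1 + q * x) * q powr (- 1 - p))) \<partial>lborel)
    = ennreal (Gamma (2 - p) / (p * (p - 1)) * x powr p)"
    unfolding nn_integral_exp_remainder_powr[OF assms, symmetric]
    by (intro nn_integral_cong) (auto split: split_indicator)
  show "Gamma (2 - p) / (p * (p - 1)) * x powr p \<ge> 0" using assms by (auto intro!: divide_nonneg_nonneg mult_nonneg_nonneg less_imp_le[OF Gamma_real_pos])
qed measurable

text \<open>\<open>stable_const\<close> is exactly the value of the jump integral of exp (-v) - 1 +
  v, so the density of index i contributes \<eta> i q^(\<alpha> i) without a further factor. If
  \<alpha> 1 = 2, the diffusion term c q^2 has the same shape and becomes the summand i = 1, so the
  sum runs over all of 1..g in both cases.\<close>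

lemma affine_generator_exp:
  assumes g: "g \<ge> 1" and \<alpha>1: "\<alpha> 1 \<le> 2"
    and dec: "\<And>i j. 1 \<le> i \<Longrightarrow> i < j \<Longrightarrow> j \<le> g \<Longrightarrow> \<alpha> j < \<alpha> i" and \<alpha>g: "\<alpha> g > 1"
    and \<eta>: "\<And>i. 1 \<le> i \<Longrightarrow> i \<le> g \<Longrightarrow> \<eta> i > 0" and q: "q > 0"
  shows "affine_generator g a b \<alpha> \<eta> (\<lambda>x. exp (- q * x)) x
    = exp (- q * x) * (x * ((\<Sum>i = 1..g. \<eta> i * q powr \<alpha> i) - a * q) - b * q)"
proof -
  let ?l = "first_jump_index \<alpha>" and ?f = "\<lambda>x::real. exp (- q * x)"
  have range: "1 < \<alpha> i \<and> \<alpha> i < 2" if i: "i \<in> {?l..g}" for i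
  proof -
    have "1 \<le> i" "i \<le> g" using i by (auto simp: first_jump_index_def split: if_splits)
    moreover have "\<alpha> g \<le> \<alpha> i" using dec[of i g] \<open>1 \<le> i\<close> \<open>i \<le> g\<close> by (cases "i = g") auto
    moreover have "\<alpha> i < 2"
    proof (cases "i = 1")
      case True
      then show ?thesis using i \<alpha>1 by (auto simp: first_jump_index_def split: if_splits)
    next
      case False
      then show ?thesis using dec[of 1 i] \<open>1 \<le> i\<close> \<open>i \<le> g\<close> \<alpha>1 by auto
    qed
    ultimately show ?thesis using \<alpha>g by auto
  qed
  have \<eta>_pos: "\<eta> i > 0" if "i \<in> {?l..g}" for i
    using that by (intro \<eta>) (auto simp: first_jump_index_def split: if_splits)
  have c_pos: "stable_const (\<alpha> i) > 0" if "i \<in> {?l..g}" for i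
    using range[OF that] by (auto simp: stable_const_def Gamma_real_pos)
  have deriv_f: "deriv ?f = (\<lambda>x. - q * exp (- q * x))"
    by (intro ext DERIV_imp_deriv) (auto intro!: derivative_eq_intros)
  have deriv2_f: "deriv (deriv ?f) = (\<lambda>x. q\<^sup>2 * exp (- q * x))"
    unfolding deriv_f by (intro ext DERIV_imp_deriv) (auto intro!: derivative_eq_intros simp: power2_eq_square)
  have "(\<integral>v. (?f (x + v) - ?f x - deriv ?f x * v) \<partial>jump_measure g \<alpha> \<eta>)
    = (\<integral>v. (indicator {0<..} v * (\<Sum>i = ?l..g. (\<eta> i / stable_const (\<alpha> i)) / v powr (1 + \<alpha> i)))
        *\<^sub>R (?f (x + v) - ?f x - deriv ?f x * v) \<partial>lborel)"
    unfolding jump_measure_def deriv_f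
  proof (intro integral_density AE_I2)
    fix v :: real
    have "0 \<le> (\<Sum>i = ?l..g. (\<eta> i / stable_const (\<alpha> i)) / v powr (1 + \<alpha> i))"
      using \<eta>_pos c_pos by (intro sum_nonneg divide_nonneg_nonneg) (auto intro: less_imp_le)
    then show "0 \<le> indicator {0<..} v * (\<Sum>i = ?l..g. (\<eta> i / stable_const (\<alpha> i)) / v powr (1 + \<alpha> i))"
      by (intro mult_nonneg_nonneg) auto
  qed measurable
  \<comment> \<open>The roles are exchanged here: the jump size v is the integration variable of the
    exponential remainder integral, and q is its fixed argument.\<close>
  also have "\<dots> = (\<integral>v. (\<Sum>i = ?l..g. (exp (- q * x) * (\<eta> i / stable_const (\<alpha> i))) *
      (indicator {0<..} v * ((exp (- v * q) - 1 + v * q) * v powr (- 1 - \<alpha> i)))) \<partial>lborel)"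
    unfolding deriv_f
  proof (intro Bochner_Integration.integral_cong refl)
    fix v :: real
    have e: "exp (- q * (x + v)) = exp (- q * x) * exp (- v * q)"
      by (simp add: algebra_simps flip: exp_add)
    have pw: "v powr (- 1 - \<alpha> i) = inverse (v powr (1 + \<alpha> i))" for i
      by (simp flip: powr_minus)
    show "(indicator {0<..} v * (\<Sum>i = ?l..g. (\<eta> i / stable_const (\<alpha> i)) / v powr (1 + \<alpha> i)))
        *\<^sub>R (?f (x + v) - ?f x - (- q * exp (- q * x)) * v)
      = (\<Sum>i = ?l..g. (exp (- q * x) * (\<eta> i / stable_const (\<alpha> i))) *
          (indicator {0<..} v * ((exp (- v * q) - 1 + v * q) * v powr (- 1 - \<alpha> i))))"
      unfolding e pw real_scaleR_def sum_distrib_left sum_distrib_right divide_inverse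
      by (intro sum.cong refl) (simp add: algebra_simps)
  qed
  also have "\<dots> = (\<Sum>i = ?l..g. (exp (- q * x) * (\<eta> i / stable_const (\<alpha> i))) *
      (Gamma (2 - \<alpha> i) / (\<alpha> i * (\<alpha> i - 1)) * q powr \<alpha> i))"
    using range q
    by (intro has_bochner_integral_integral_eq has_bochner_integral_sum has_bochner_integral_mult_right
        has_bochner_integral_exp_remainder_powr) auto
  also have "\<dots> = exp (- q * x) * (\<Sum>i = ?l..g. \<eta> i * q powr \<alpha> i)"
    unfolding sum_distrib_left
  proof (intro sum.cong refl)
    fix i assume i: "i \<in> {?l..g}"
    then have "Gamma (2 - \<alpha> i) / (\<alpha> i * (\<alpha> i - 1)) = stable_const (\<alpha> i)"
      using range[OF i] by (simp add: stable_const_def)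
    then show "(exp (- q * x) * (\<eta> i / stable_const (\<alpha> i))) *
      (Gamma (2 - \<alpha> i) / (\<alpha> i * (\<alpha> i - 1)) * q powr \<alpha> i) = exp (- q * x) * (\<eta> i * q powr \<alpha> i)"
      using c_pos[OF i] by simp
  qed
  finally have int: "(\<integral>v. (?f (x + v) - ?f x - deriv ?f x * v) \<partial>jump_measure g \<alpha> \<eta>)
    = exp (- q * x) * (\<Sum>i = ?l..g. \<eta> i * q powr \<alpha> i)" .
  have "(\<Sum>i = 1..g. \<eta> i * q powr \<alpha> i) = diffusion_coeff \<alpha> \<eta> * q\<^sup>2 + (\<Sum>i = ?l..g. \<eta> i * q powr \<alpha> i)"
    using g q by (auto simp: diffusion_coeff_def first_jump_index_def sum.atLeast_Suc_atMost numeral_2_eq_2)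
  then show ?thesis
    by (simp only: affine_generator_def int deriv2_f) (simp only: deriv_f, simp add: algebra_simps)
qed

text \<open>The error of the generator quotient is uniform in the state, so averaging over the law
  of \<open>R t\<close> gives an error uniform in t. That is the uniformity under which forward
  quotients determine a derivative.\<close>

lemma nonneg_markov_process_generator_derivative:
  fixes f G :: "real \<Rightarrow> real"
  assumes mp: "nonneg_markov_process M R P"
    and gen: "uniform_limit {0..} (\<lambda>h x. ((\<integral>y. f y \<partial>P h x) - f x) / h) G (at_right 0)"
    and f: "f \<in> borel_measurable half_line" and f_bdd: "\<And>x. x \<ge> 0 \<Longrightarrow> \<bar>f x\<bar> \<le> B"
    and G: "G \<in> borel_measurable half_line" and G_bdd: "\<And>x. x \<ge> 0 \<Longrightarrow> \<bar>G x\<bar> \<le> C"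
    and t: "t \<ge> 0"
  shows "((\<lambda>t. \<integral>\<omega>. f (R t \<omega>) \<partial>M) has_real_derivative (\<integral>\<omega>. G (R t \<omega>) \<partial>M)) (at t within {0..})"
proof (rule has_real_derivative_of_uniform_right_derivative[where B = C and \<psi> = "\<lambda>t. \<integral>\<omega>. G (R t \<omega>) \<partial>M"])
  interpret prob_space M using mp by (simp add: nonneg_markov_process_def)
  have R_meas: "R u \<in> M \<rightarrow>\<^sub>M half_line" if "0 \<le> u" for u
    using mp that by (simp add: nonneg_markov_process_def)
  have R_nonneg: "R u \<omega> \<ge> 0" if "0 \<le> u" "\<omega> \<in> space M" for u \<omega>
    using measurable_space[OF R_meas[OF that(1)] that(2)] by (simp add: space_restrict_space)
  have int: "integrable M (\<lambda>\<omega>. h (R u \<omega>))"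
    if "h \<in> borel_measurable half_line" "\<And>x. x \<ge> 0 \<Longrightarrow> \<bar>h x\<bar> \<le> K" "0 \<le> u" for h :: "real \<Rightarrow> real" and K u
    using that R_nonneg measurable_compose[OF R_meas[OF that(3)] that(1)]
    by (intro integrable_const_bound[where B = K]) auto
  have P_meas: "P u \<in> half_line \<rightarrow>\<^sub>M prob_algebra half_line" if "0 \<le> u" for u
    using mp that by (simp add: nonneg_markov_process_def transition_semigroup_def)
  have Pf_meas: "(\<lambda>x. \<integral>y. f y \<partial>P h x) \<in> borel_measurable half_line" if "0 \<le> h" for h
    by (rule measurable_compose[OF measurable_prob_algebraD[OF P_meas[OF that]]
          integral_measurable_subprob_algebra[OF f]])
  have Pf_bdd: "\<bar>\<integral>y. f y \<partial>P h x\<bar> \<le> B" if "0 \<le> h" "x \<ge> 0" for h x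
  proof -
    have P: "prob_space (P h x)" "sets (P h x) = sets half_line"
      using measurable_space[OF P_meas[OF that(1)], of x] that(2)
      by (auto simp: space_prob_algebra space_restrict_space)
    have sp: "space (P h x) = {0..}"
      using sets_eq_imp_space_eq[OF P(2)] by (simp add: space_restrict_space)
    interpret P: prob_space "P h x" by (rule P)
    have "f \<in> borel_measurable (P h x)" using f P(2) by (simp cong: measurable_cong_sets)
    then have "integrable (P h x) f"
      using f_bdd sp by (intro P.integrable_const_bound[where B = B]) auto
    then have "(\<integral>y. f y \<partial>P h x) \<in> {-B..B}"
      using f_bdd sp by (auto intro!: P.integral_le_const P.integral_ge_const AE_I2 dest: abs_le_D1 abs_le_D2)
        (smt (verit) abs_le_D2)+
    then show ?thesis by auto
  qed
  show "uniform_limit {0..} (\<lambda>h t. ((\<integral>\<omega>. f (R (t + h) \<omega>) \<partial>M) - (\<integral>\<omega>. f (R t \<omega>) \<partial>M)) / h)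
    (\<lambda>t. \<integral>\<omega>. G (R t \<omega>) \<partial>M) (at_right 0)"
  proof (rule uniform_limitI)
    fix e :: real assume e: "e > 0"
    have "\<forall>\<^sub>F h in at_right 0. \<forall>x\<in>{0..}. dist (((\<integral>y. f y \<partial>P h x) - f x) / h) (G x) < e / 2"
      using uniform_limitD[OF gen, of "e / 2"] e by simp
    with eventually_at_right_less[of 0]
    show "\<forall>\<^sub>F h in at_right 0. \<forall>t\<in>{0..}.
      dist (((\<integral>\<omega>. f (R (t + h) \<omega>) \<partial>M) - (\<integral>\<omega>. f (R t \<omega>) \<partial>M)) / h) (\<integral>\<omega>. G (R t \<omega>) \<partial>M) < e"
    proof eventually_elim
      case (elim h)
      show ?case
      proof
        fix t :: real assume "t \<in> {0..}"
        then have t: "t \<ge> 0" by simp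
        have h: "h > 0" using elim by simp
        have i1: "integrable M (\<lambda>\<omega>. \<integral>y. f y \<partial>P h (R t \<omega>))"
          using int[OF Pf_meas Pf_bdd t] h by simp
        have i2: "integrable M (\<lambda>\<omega>. f (R t \<omega>))" using int[OF f f_bdd t] .
        have i3: "integrable M (\<lambda>\<omega>. G (R t \<omega>))" using int[OF G G_bdd t] .
        have "((\<integral>\<omega>. f (R (t + h) \<omega>) \<partial>M) - (\<integral>\<omega>. f (R t \<omega>) \<partial>M)) / h - (\<integral>\<omega>. G (R t \<omega>) \<partial>M)
          = (\<integral>\<omega>. ((\<integral>y. f y \<partial>P h (R t \<omega>)) - f (R t \<omega>)) / h - G (R t \<omega>) \<partial>M)"
          using h i1 i2 i3 nonneg_markov_process_integral[OF mp t less_imp_le[OF h] f f_bdd] by simp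
        also have "\<bar>\<dots>\<bar> \<le> (\<integral>\<omega>. \<bar>((\<integral>y. f y \<partial>P h (R t \<omega>)) - f (R t \<omega>)) / h - G (R t \<omega>)\<bar> \<partial>M)"
          by (rule integral_abs_bound)
        also have "\<dots> \<le> e / 2"
          using i1 i2 i3 elim R_nonneg[OF t] by (intro integral_le_const) (auto simp: dist_real_def intro: less_imp_le)
        also have "\<dots> < e" using e by simp
        finally show "dist (((\<integral>\<omega>. f (R (t + h) \<omega>) \<partial>M) - (\<integral>\<omega>. f (R t \<omega>) \<partial>M)) / h) (\<integral>\<omega>. G (R t \<omega>) \<partial>M) < e"
          by (simp add: dist_real_def)
      qed
    qed
  qed
  show "\<bar>\<integral>\<omega>. G (R t \<omega>) \<partial>M\<bar> \<le> C" if t: "t \<ge> 0" for t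
  proof -
    have "\<bar>\<integral>\<omega>. G (R t \<omega>) \<partial>M\<bar> \<le> (\<integral>\<omega>. \<bar>G (R t \<omega>)\<bar> \<partial>M)" by (rule integral_abs_bound)
    also have "\<dots> \<le> C"
      using int[OF G G_bdd t] R_nonneg[OF t] G_bdd by (intro integral_le_const) auto
    finally show ?thesis .
  qed
qed (rule t)

text \<open>A second-order Taylor bound in q that does not depend on y: the factor y^2 of the
  remainder is absorbed by exp (-q0 y). The constant comes from u <= exp u at u = y q0 / 2, squared.
  After integration it needs no second moment.\<close>

lemma exp_neg_tangent_bound:
  fixes q q' y :: real
  assumes "q0 > 0" "q \<ge> q0" "q' \<ge> q0" "y \<ge> 0"
  shows "\<bar>exp (- q' * y) - exp (- q * y) + (q' - q) * (y * exp (- q * y))\<bar> \<le> 4 / q0\<^sup>2 * (q' - q)\<^sup>2"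
proof -
  define z where "z = - (q' - q) * y"
  have eq: "exp (- q' * y) - exp (- q * y) + (q' - q) * (y * exp (- q * y)) = exp (- q * y) * (exp z - 1 - z)"
  proof -
    have "exp (- q' * y) = exp (- q * y) * exp z"
      by (simp add: z_def algebra_simps flip: exp_add)
    then show ?thesis by (simp add: z_def algebra_simps)
  qed
  have lower: "exp z - 1 - z \<ge> 0" using exp_ge_add_one_self[of z] by linarith
  have inv: "exp z * (1 - z) \<le> 1"
    using mult_left_mono[OF exp_ge_add_one_self[of "-z"], of "exp z"] by (simp add: exp_minus)
  \<comment> \<open>The factor \<open>max 1 (exp z)\<close> treats both signs of z together; times
    exp (-q y) it is the larger of exp (-q y) and exp (-q' y), hence at most exp (-q0 y).\<close>
  have upper: "exp z - 1 - z \<le> z\<^sup>2 * max 1 (exp z)"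
  proof -
    have "exp z - 1 - z \<le> z * (exp z - 1)" using inv by (simp add: algebra_simps)
    also have "\<dots> \<le> z\<^sup>2 * max 1 (exp z)"
    proof (cases "z \<ge> 0")
      case True
      have "z * (exp z - 1) \<le> z * (z * exp z)" using inv True by (intro mult_left_mono) (auto simp: algebra_simps)
      also have "\<dots> \<le> z\<^sup>2 * max 1 (exp z)"
        by (simp add: power2_eq_square mult.assoc[symmetric] mult_left_mono)
      finally show ?thesis .
    next
      case False
      have "(- z) * (1 - exp z) \<le> (- z) * (- z)"
        using False exp_ge_add_one_self[of z] by (intro mult_left_mono; linarith)
      also have "\<dots> \<le> z\<^sup>2 * max 1 (exp z)"
        using mult_left_mono[of 1 "max 1 (exp z)" "z\<^sup>2"] by (simp add: power2_eq_square)
      finally show ?thesis by (simp add: algebra_simps)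
    qed
    finally show ?thesis .
  qed
  have "exp (- q * y) * max 1 (exp z) = max (exp (- q * y)) (exp (- q' * y))"
    by (auto simp: max_def z_def algebra_simps simp flip: exp_add)
  also have "\<dots> \<le> exp (- q0 * y)" using assms by (auto intro!: mult_right_mono)
  finally have m: "exp (- q * y) * max 1 (exp z) \<le> exp (- q0 * y)" .
  have "y * q0 / 2 \<le> exp (y * q0 / 2)"
    using exp_ge_add_one_self[of "y * q0 / 2"] by linarith
  then have "(y * q0 / 2)\<^sup>2 \<le> (exp (y * q0 / 2))\<^sup>2"
    using assms by (intro power_mono) auto
  also have "(exp (y * q0 / 2))\<^sup>2 = exp (y * q0)"
    by (simp add: power2_eq_square flip: exp_add)
  finally have y2: "y\<^sup>2 * exp (- q0 * y) \<le> 4 / q0\<^sup>2"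
    using assms by (simp add: exp_minus field_simps power2_eq_square)
  have "exp (- q * y) * (exp z - 1 - z) \<le> exp (- q * y) * (z\<^sup>2 * max 1 (exp z))"
    using upper by (intro mult_left_mono) auto
  also have "\<dots> = z\<^sup>2 * (exp (- q * y) * max 1 (exp z))" by simp
  also have "\<dots> \<le> z\<^sup>2 * exp (- q0 * y)" using m by (intro mult_left_mono) auto
  also have "\<dots> = (y\<^sup>2 * exp (- q0 * y)) * (q' - q)\<^sup>2" by (simp add: z_def power_mult_distrib power2_commute[of q q'])
  also have "\<dots> \<le> 4 / q0\<^sup>2 * (q' - q)\<^sup>2" using y2 by (intro mult_right_mono) auto
  finally show ?thesis unfolding eq using lower by (simp add: abs_mult)
qed

lemma mult_exp_neg_le:
  fixes q y :: real
  assumes "q > 0"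
  shows "y * exp (- q * y) \<le> 1 / q"
proof -
  have "q * y \<le> exp (q * y)" using exp_ge_add_one_self[of "q * y"] by linarith
  then show ?thesis using assms by (simp add: exp_minus field_simps)
qed

section \<open>Laplace transforms of nonnegative random variables\<close>

text \<open>Interpreted twice, for the short rate itself and for its discounted version, so that
  their Laplace transforms can be compared.\<close>

locale nonneg_family = prob_space M for M :: "'w measure" +
  fixes X :: "real \<Rightarrow> 'w \<Rightarrow> real"
  assumes X_measurable: "0 \<le> t \<Longrightarrow> X t \<in> borel_measurable M"
    and X_nonneg: "0 \<le> t \<Longrightarrow> \<omega> \<in> space M \<Longrightarrow> 0 \<le> X t \<omega>"
begin

definition lap :: "real \<Rightarrow> real \<Rightarrow> real" where
  "lap t q = (\<integral>\<omega>. exp (- q * X t \<omega>) \<partial>M)"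

text \<open>Minus the derivative of \<open>lap t\<close> at q. It is finite for q > 0 without any
  moment assumption, since y exp (-q y) is bounded.\<close>

definition lap_mom :: "real \<Rightarrow> real \<Rightarrow> real" where
  "lap_mom t q = (\<integral>\<omega>. X t \<omega> * exp (- q * X t \<omega>) \<partial>M)"

lemma integrable_exp: "0 \<le> t \<Longrightarrow> 0 \<le> q \<Longrightarrow> integrable M (\<lambda>\<omega>. exp (- q * X t \<omega>))"
  using X_measurable X_nonneg by (intro integrable_const_bound[where B = 1]) auto

lemma integrable_mult_exp: "0 \<le> t \<Longrightarrow> 0 < q \<Longrightarrow> integrable M (\<lambda>\<omega>. X t \<omega> * exp (- q * X t \<omega>))"
  using X_measurable X_nonneg mult_exp_neg_le[of q]
  by (intro integrable_const_bound[where B = "1 / q"] AE_I2) simp_all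

lemma lap_bounds:
  assumes "0 \<le> t" "0 \<le> q"
  shows "0 \<le> lap t q" "lap t q \<le> 1"
proof -
  show "0 \<le> lap t q" unfolding lap_def by (rule Bochner_Integration.integral_nonneg) simp
  show "lap t q \<le> 1" unfolding lap_def
    using assms X_nonneg by (intro integral_le_const integrable_exp AE_I2) simp_all
qed

lemma lap_mom_bounds:
  assumes "0 \<le> t" "0 < q"
  shows "0 \<le> lap_mom t q" "lap_mom t q \<le> 1 / q"
proof -
  show "0 \<le> lap_mom t q" unfolding lap_mom_def
    using assms X_nonneg by (intro integral_nonneg_AE AE_I2) simp
  show "lap_mom t q \<le> 1 / q" unfolding lap_mom_def
    using assms by (intro integral_le_const integrable_mult_exp AE_I2 mult_exp_neg_le)
qed

lemma lap_tangent_bound: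
  assumes t: "0 \<le> t" and q: "0 < q0" "q0 \<le> q" "q0 \<le> q'"
  shows "\<bar>lap t q' - lap t q + (q' - q) * lap_mom t q\<bar> \<le> 4 / q0\<^sup>2 * (q' - q)\<^sup>2"
proof -
  let ?d = "\<lambda>\<omega>. exp (- q' * X t \<omega>) - exp (- q * X t \<omega>) + (q' - q) * (X t \<omega> * exp (- q * X t \<omega>))"
  have "0 \<le> q" "0 < q" "0 \<le> q'" using q by auto
  note int = integrable_exp[OF t this(3)] integrable_exp[OF t this(1)] integrable_mult_exp[OF t this(2)]
  have "has_bochner_integral M ?d (lap t q' - lap t q + (q' - q) * lap_mom t q)"
    unfolding lap_def lap_mom_def
    by (intro has_bochner_integral_add has_bochner_integral_diff has_bochner_integral_mult_right
        has_bochner_integral_integrable int)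
  then have d: "integrable M ?d" "lap t q' - lap t q + (q' - q) * lap_mom t q = (\<integral>\<omega>. ?d \<omega> \<partial>M)"
    by (auto simp: has_bochner_integral_iff)
  have "\<bar>\<integral>\<omega>. ?d \<omega> \<partial>M\<bar> \<le> (\<integral>\<omega>. \<bar>?d \<omega>\<bar> \<partial>M)"
    by (rule integral_abs_bound)
  also have "\<dots> \<le> 4 / q0\<^sup>2 * (q' - q)\<^sup>2"
    by (rule integral_le_const[OF integrable_abs[OF d(1)] AE_I2[OF exp_neg_tangent_bound[OF q X_nonneg[OF t]]]])
  finally show ?thesis unfolding d(2) .
qed

text \<open>The function y exp (-q y) is not among the test functions, so its expectation has no
  evolution equation of its own. Continuity in t is inherited from \<open>lap\<close> because the
  difference quotients in q converge uniformly in t.\<close>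

lemma lap_mom_continuous:
  assumes lap: "\<And>q. 0 < q \<Longrightarrow> continuous_on {0..} (\<lambda>t. lap t q)" and q: "0 < q"
  shows "continuous_on {0..} (\<lambda>t. lap_mom t q)"
proof (rule uniform_limit_theorem[where F = "at_right 0" and f = "\<lambda>h t. (lap t q - lap t (q + h)) / h"])
  show "\<forall>\<^sub>F h in at_right 0. continuous_on {0..} (\<lambda>t. (lap t q - lap t (q + h)) / h)"
    using eventually_at_right_less[of 0]
  proof eventually_elim
    case (elim h)
    then show ?case using q by (intro continuous_on_divide continuous_on_diff lap continuous_on_const) auto
  qed
  show "uniform_limit {0..} (\<lambda>h t. (lap t q - lap t (q + h)) / h) (\<lambda>t. lap_mom t q) (at_right 0)"
  proof (rule uniform_limitI)
    fix e :: real assume e: "0 < e"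
    have "\<forall>\<^sub>F h in at_right 0. 0 < h \<and> h < e * q\<^sup>2 / 4"
      using e q by (auto simp: eventually_at_right_field intro!: exI[of _ "e * q\<^sup>2 / 4"])
    then show "\<forall>\<^sub>F h in at_right 0. \<forall>t\<in>{0..}. dist ((lap t q - lap t (q + h)) / h) (lap_mom t q) < e"
    proof eventually_elim
      case (elim h)
      show ?case
      proof
        fix t :: real assume t: "t \<in> {0..}"
        have "\<bar>lap t (q + h) - lap t q + h * lap_mom t q\<bar> \<le> 4 / q\<^sup>2 * h\<^sup>2"
          using lap_tangent_bound[of t q q "q + h"] t q elim by simp
        then have "\<bar>(lap t (q + h) - lap t q + h * lap_mom t q) / h\<bar> \<le> 4 / q\<^sup>2 * h"
          using elim by (simp add: abs_divide divide_le_eq power2_eq_square)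
        also have "(lap t (q + h) - lap t q + h * lap_mom t q) / h = - ((lap t q - lap t (q + h)) / h - lap_mom t q)"
          using elim by (simp add: field_simps)
        also have "4 / q\<^sup>2 * h < e" using elim q by (simp add: field_simps)
        finally show "dist ((lap t q - lap t (q + h)) / h) (lap_mom t q) < e"
          by (simp add: dist_real_def)
      qed
    qed
  qed
qed simp

text \<open>Differentiability in time is known for a fixed argument only. Moving the argument from
  \<kappa> t to \<kappa> s at time s is linear up to a remainder quadratic in \<kappa> s - \<kappa>
  t, uniformly in s, so joint differentiability is avoided; continuity of \<open>lap_mom\<close> in
  time carries its coefficient from s to t.\<close>

lemma lap_chain_rule:
  assumes t: "0 \<le> t" and lap: "((\<lambda>s. lap s (\<kappa> t)) has_real_derivative L) (at t within {0..})"
    and \<kappa>: "(\<kappa> has_real_derivative \<kappa>') (at t within {0..})" and pos: "0 < \<kappa> t"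
    and mom: "continuous (at t within {0..}) (\<lambda>s. lap_mom s (\<kappa> t))"
  shows "((\<lambda>s. lap s (\<kappa> s)) has_real_derivative L - \<kappa>' * lap_mom t (\<kappa> t)) (at t within {0..})"
proof -
  let ?F = "at t within {0..}"
  define rem where "rem s = lap s (\<kappa> s) - lap s (\<kappa> t) + (\<kappa> s - \<kappa> t) * lap_mom s (\<kappa> t)" for s
  have \<kappa>_lim: "(\<kappa> \<longlongrightarrow> \<kappa> t) ?F"
    using DERIV_continuous[OF \<kappa>] by (simp add: continuous_within)
  have \<kappa>_quot: "((\<lambda>s. (\<kappa> s - \<kappa> t) / (s - t)) \<longlongrightarrow> \<kappa>') ?F"
    using \<kappa> by (simp add: has_field_derivative_iff)
  have "\<forall>\<^sub>F s in ?F. \<kappa> s > \<kappa> t / 2" using order_tendstoD(1)[OF \<kappa>_lim, of "\<kappa> t / 2"] pos by simp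
  moreover have "\<forall>\<^sub>F s in ?F. s \<in> {0..} \<and> s \<noteq> t" by (auto simp: eventually_at_filter)
  \<comment> \<open>Near t both \<kappa> s and \<kappa> t stay above \<kappa> t / 2, which serves as
    the lower bound q0 of the tangent estimate.\<close>
  ultimately have bound: "\<forall>\<^sub>F s in ?F. norm (rem s / (s - t)) \<le> 4 / (\<kappa> t / 2)\<^sup>2 * (\<bar>\<kappa> s - \<kappa> t\<bar> * \<bar>(\<kappa> s - \<kappa> t) / (s - t)\<bar>)"
  proof eventually_elim
    case (elim s)
    have "\<bar>rem s\<bar> \<le> 4 / (\<kappa> t / 2)\<^sup>2 * (\<kappa> s - \<kappa> t)\<^sup>2"
      unfolding rem_def using elim pos by (intro lap_tangent_bound) auto
    then have "\<bar>rem s\<bar> / \<bar>s - t\<bar> \<le> 4 / (\<kappa> t / 2)\<^sup>2 * (\<kappa> s - \<kappa> t)\<^sup>2 / \<bar>s - t\<bar>"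
      by (intro divide_right_mono) auto
    then show ?case by (simp add: abs_divide power2_eq_square flip: abs_mult)
  qed
  have "((\<lambda>s. 4 / (\<kappa> t / 2)\<^sup>2 * (\<bar>\<kappa> s - \<kappa> t\<bar> * \<bar>(\<kappa> s - \<kappa> t) / (s - t)\<bar>)) \<longlongrightarrow> 4 / (\<kappa> t / 2)\<^sup>2 * (\<bar>\<kappa> t - \<kappa> t\<bar> * \<bar>\<kappa>'\<bar>)) ?F"
    by (intro tendsto_intros \<kappa>_lim \<kappa>_quot)
  then have rem: "((\<lambda>s. rem s / (s - t)) \<longlongrightarrow> 0) ?F"
    by (intro Lim_null_comparison[OF bound]) simp
  have "((\<lambda>s. (lap s (\<kappa> t) - lap t (\<kappa> t)) / (s - t) - (\<kappa> s - \<kappa> t) / (s - t) * lap_mom s (\<kappa> t) + rem s / (s - t))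
      \<longlongrightarrow> L - \<kappa>' * lap_mom t (\<kappa> t) + 0) ?F"
    using lap mom by (intro tendsto_intros rem \<kappa>_quot) (auto simp: has_field_derivative_iff continuous_within)
  moreover have "(lap s (\<kappa> t) - lap t (\<kappa> t)) / (s - t) - (\<kappa> s - \<kappa> t) / (s - t) * lap_mom s (\<kappa> t) + rem s / (s - t)
      = (lap s (\<kappa> s) - lap t (\<kappa> t)) / (s - t)" for s
    unfolding rem_def by (simp add: divide_inverse algebra_simps)
  ultimately show ?thesis by (simp add: has_field_derivative_iff)
qed

text \<open>Tangent estimate plus the bound 1 / q0 on the slope; nearness turns the square of q' - q
  into its absolute value. The constant is free of t, as joint continuity demands.\<close>

lemma lap_lipschitz:
  assumes t: "0 \<le> t" and q: "0 < q0" "q0 \<le> q" "q0 \<le> q'" and near: "\<bar>q' - q\<bar> \<le> 1"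
  shows "\<bar>lap t q' - lap t q\<bar> \<le> (4 / q0\<^sup>2 + 1 / q0) * \<bar>q' - q\<bar>"
proof -
  have abs_le: "\<bar>u\<bar> \<le> c + d" if "\<bar>u + v\<bar> \<le> c" "\<bar>v\<bar> \<le> d" for u v c d :: real
    using that by linarith
  have "(q' - q)\<^sup>2 \<le> 1 * \<bar>q' - q\<bar>"
    using near mult_right_mono[OF near, of "\<bar>q' - q\<bar>"] by (simp add: power2_eq_square flip: abs_mult)
  then have "4 / q0\<^sup>2 * (q' - q)\<^sup>2 \<le> 4 / q0\<^sup>2 * \<bar>q' - q\<bar>"
    by (intro mult_left_mono) auto
  with lap_tangent_bound[OF t q]
  have 1: "\<bar>lap t q' - lap t q + (q' - q) * lap_mom t q\<bar> \<le> 4 / q0\<^sup>2 * \<bar>q' - q\<bar>"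
    by (rule order_trans)
  have "0 < q" using q by simp
  have "lap_mom t q \<le> 1 / q0"
    by (rule order_trans[OF lap_mom_bounds(2)[OF t \<open>0 < q\<close>]]) (use q in \<open>auto intro: divide_left_mono\<close>)
  then have 2: "\<bar>(q' - q) * lap_mom t q\<bar> \<le> 1 / q0 * \<bar>q' - q\<bar>"
    using lap_mom_bounds(1)[OF t \<open>0 < q\<close>] mult_right_mono[of "lap_mom t q" "1 / q0" "\<bar>q' - q\<bar>"]
    by (simp add: abs_mult mult.commute)
  show ?thesis unfolding distrib_right by (rule abs_le[OF 1 2])
qed

text \<open>Add the tangent estimates at q and at q': the values of \<open>lap\<close> cancel and
  leave (q' - q) times the difference of the slopes, from which one factor is divided out.\<close>

lemma lap_mom_lipschitz:
  assumes t: "0 \<le> t" and q: "0 < q0" "q0 \<le> q" "q0 \<le> q'"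
  shows "\<bar>lap_mom t q' - lap_mom t q\<bar> \<le> 8 / q0\<^sup>2 * \<bar>q' - q\<bar>"
proof (cases "q' = q")
  case False
  have abs_le: "\<bar>z * (x - y)\<bar> \<le> c + c" if "\<bar>v - u + z * y\<bar> \<le> c" "\<bar>u - v + (- z) * x\<bar> \<le> c" for u v x y z c :: real
    using that by (simp add: algebra_simps abs_le_iff)
  have "\<bar>(q' - q) * (lap_mom t q' - lap_mom t q)\<bar> \<le> 4 / q0\<^sup>2 * (q' - q)\<^sup>2 + 4 / q0\<^sup>2 * (q' - q)\<^sup>2"
    using lap_tangent_bound[OF t q] lap_tangent_bound[OF t q(1,3,2)]
    by (intro abs_le) (simp_all add: power2_commute[of q q'])
  also have "\<dots> = \<bar>q' - q\<bar> * (8 / q0\<^sup>2 * \<bar>q' - q\<bar>)"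
  proof -
    have "(q' - q)\<^sup>2 = \<bar>q' - q\<bar> * \<bar>q' - q\<bar>" by (simp add: power2_eq_square)
    then show ?thesis by (simp only: \<open>(q' - q)\<^sup>2 = \<bar>q' - q\<bar> * \<bar>q' - q\<bar>\<close>) simp
  qed
  finally show ?thesis
    unfolding abs_mult by (rule mult_left_le_imp_le) (use False in simp)
qed simp

end

text \<open>A Lipschitz constant in q that is the same for all t upgrades separate continuity to
  joint continuity. This provides the joint measurability behind the exchange of the integrals in
  time and in q.\<close>

lemma continuous_on_prod_of_local_lipschitz:
  fixes f :: "real \<Rightarrow> real \<Rightarrow> real"
  assumes cont: "\<And>q. 0 < q \<Longrightarrow> continuous_on {0..} (\<lambda>t. f t q)"
    and lip: "\<And>t q0 q q'. 0 \<le> t \<Longrightarrow> 0 < q0 \<Longrightarrow> q0 \<le> q \<Longrightarrow> q0 \<le> q' \<Longrightarrow> \<bar>q' - q\<bar> \<le> 1 \<Longrightarrow> \<bar>f t q' - f t q\<bar> \<le> C q0 * \<bar>q' - q\<bar>"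
  shows "continuous_on ({0..} \<times> {0<..}) (\<lambda>x. f (fst x) (snd x))"
proof (clarsimp simp: continuous_on_def)
  fix t q :: real assume t: "0 \<le> t" and q: "0 < q"
  let ?F = "at (t, q) within ({0..} \<times> {0<..})"
  have fst: "(fst \<longlongrightarrow> t) ?F" and snd: "(snd \<longlongrightarrow> q) ?F"
    using tendsto_fst[OF tendsto_ident_at[of "(t, q)" "{0..} \<times> {0<..}"]]
      tendsto_snd[OF tendsto_ident_at[of "(t, q)" "{0..} \<times> {0<..}"]] by simp_all
  have main: "((\<lambda>x. f (fst x) q) \<longlongrightarrow> f t q) ?F"
    using t by (intro continuous_on_tendsto_compose[OF cont[OF q] fst])
      (auto simp: eventually_at_filter intro!: always_eventually)
  have "\<forall>\<^sub>F x in ?F. snd x > q / 2" using order_tendstoD(1)[OF snd, of "q / 2"] q by simp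
  moreover have "\<forall>\<^sub>F x in ?F. dist (snd x) q < 1" using tendstoD[OF snd, of 1] by simp
  moreover have "\<forall>\<^sub>F x in ?F. x \<in> {0..} \<times> {0<..}"
    unfolding eventually_at_filter by (rule always_eventually) blast
  \<comment> \<open>On the neighbourhood where the second coordinate exceeds q / 2 and is within 1
    of q, the single constant \<open>C (q / 2)\<close> applies.\<close>
  ultimately have bound: "\<forall>\<^sub>F x in ?F. norm (f (fst x) (snd x) - f (fst x) q) \<le> C (q / 2) * \<bar>snd x - q\<bar>"
  proof eventually_elim
    case (elim x)
    then show ?case
      unfolding real_norm_def using q by (intro lip) (simp_all add: mem_Times_iff dist_real_def)
  qed
  have "((\<lambda>x. C (q / 2) * \<bar>snd x - q\<bar>) \<longlongrightarrow> C (q / 2) * \<bar>q - q\<bar>) ?F"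
    by (intro tendsto_intros snd)
  then have "((\<lambda>x. f (fst x) (snd x) - f (fst x) q) \<longlongrightarrow> 0) ?F"
    by (intro Lim_null_comparison[OF bound]) simp
  from tendsto_add[OF this main] show "((\<lambda>x. f (fst x) (snd x)) \<longlongrightarrow> f t q) ?F"
    by (simp only: diff_add_cancel add_0)
qed

section \<open>Evolution of the Laplace transform\<close>

text \<open>In the application \<open>X t = exp (- a * t) * R t\<close>, \<open>k i t = \<eta> i * exp (a * (1 - \<alpha> i) * t)\<close> and
  \<open>\<beta> t = b * exp (- a * t)\<close>.\<close>

locale laplace_flow = nonneg_family M X for M :: "'w measure" and X +
  fixes A :: "'i set" and k :: "'i \<Rightarrow> real \<Rightarrow> real" and \<alpha> :: "'i \<Rightarrow> real" and \<beta> :: "real \<Rightarrow> real" and x0 :: real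
  assumes x0: "0 \<le> x0" and X0: "AE \<omega> in M. X 0 \<omega> = x0" and fin: "finite A"
    and k_cont: "i \<in> A \<Longrightarrow> continuous_on {0..} (k i)" and k_nonneg: "i \<in> A \<Longrightarrow> 0 \<le> t \<Longrightarrow> 0 \<le> k i t"
    and \<beta>_cont: "continuous_on {0..} \<beta>" and \<beta>_nonneg: "0 \<le> t \<Longrightarrow> 0 \<le> \<beta> t"
    and lap_deriv: "0 \<le> t \<Longrightarrow> 0 < q \<Longrightarrow> ((\<lambda>t. lap t q) has_real_derivative
      (\<Sum>i\<in>A. k i t * q powr \<alpha> i) * lap_mom t q - \<beta> t * q * lap t q) (at t within {0..})"
begin

lemma lap_cont: "0 < q \<Longrightarrow> continuous_on {0..} (\<lambda>t. lap t q)"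
  by (auto simp: continuous_on_eq_continuous_within intro!: DERIV_continuous[OF lap_deriv])

lemma lap_mom_cont: "0 < q \<Longrightarrow> continuous_on {0..} (\<lambda>t. lap_mom t q)"
  by (rule lap_mom_continuous[OF lap_cont])

lemma lap_0: "lap 0 q = exp (- q * x0)"
proof -
  have "lap 0 q = (\<integral>\<omega>. exp (- q * x0) \<partial>M)"
    unfolding lap_def
  proof (rule integral_cong_AE)
    show "(\<lambda>\<omega>. exp (- q * X 0 \<omega>)) \<in> borel_measurable M" using X_measurable[of 0] by simp
  qed (use X0 in auto)
  then show ?thesis by (simp add: prob_space)
qed

text \<open>The mean that results from formally applying the generator to the identity: after
  discounting only \<beta> contributes. It is used as an upper bound for the mean.\<close>

definition drift :: "real \<Rightarrow> real" where
  "drift t = x0 + integral {0..t} \<beta>"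

text \<open>\<open>gain t q\<close> is the time derivative of \<open>lap t q + q * drift t\<close>, hence governs the growth of
  \<open>E (exp (- q * X t) - 1 + q * X t)\<close>; unlike the derivative of \<open>lap\<close> alone it is nonnegative.\<close>

definition gain :: "real \<Rightarrow> real \<Rightarrow> real" where
  "gain t q = (\<Sum>i\<in>A. k i t * q powr \<alpha> i) * lap_mom t q + \<beta> t * q * (1 - lap t q)"

lemma gain_nonneg: "0 \<le> t \<Longrightarrow> 0 < q \<Longrightarrow> 0 \<le> gain t q"
  unfolding gain_def using lap_bounds[of t q] lap_mom_bounds[of t q] k_nonneg \<beta>_nonneg
  by (intro add_nonneg_nonneg mult_nonneg_nonneg sum_nonneg) auto

lemma gain_cont_prod: "continuous_on ({0..} \<times> {0<..}) (\<lambda>x. gain (fst x) (snd x))"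
proof -
  have lap: "continuous_on ({0..} \<times> {0<..}) (\<lambda>x. lap (fst x) (snd x))"
    by (rule continuous_on_prod_of_local_lipschitz[OF lap_cont lap_lipschitz])
  have mom: "continuous_on ({0..} \<times> {0<..}) (\<lambda>x. lap_mom (fst x) (snd x))"
    by (rule continuous_on_prod_of_local_lipschitz[OF lap_mom_cont lap_mom_lipschitz])
  have fst: "continuous_on ({0..} \<times> {0<..}) (\<lambda>x :: real \<times> real. h (fst x))"
    if "continuous_on {0..} h" for h :: "real \<Rightarrow> real"
    by (rule continuous_on_compose2[OF that]) (auto intro!: continuous_intros)
  have pw: "continuous_on ({0..} \<times> {0<..}) (\<lambda>x :: real \<times> real. snd x powr r)" for r
    by (intro continuous_intros) auto
  show ?thesis
    unfolding gain_def
    by (intro continuous_on_add continuous_on_mult continuous_on_sum continuous_on_diff continuous_on_const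
        continuous_on_snd continuous_on_id fst pw lap mom k_cont \<beta>_cont)
qed

lemma gain_cont:
  assumes "0 < q" shows "continuous_on {0..} (\<lambda>t. gain t q)"
proof -
  have "continuous_on {0..} (\<lambda>t. (t, q))" by (intro continuous_intros)
  from continuous_on_compose2[OF gain_cont_prod this] assms show ?thesis by auto
qed

lemma gain_measurable:
  "(\<lambda>x. indicator ({0..} \<times> {0<..}) x * gain (fst x) (snd x)) \<in> borel_measurable (borel \<Otimes>\<^sub>M borel)"
  using borel_measurable_continuous_on_indicator[OF _ gain_cont_prod]
  by (simp add: borel_prod borel_Times)

text \<open>Splitting -\<beta> q lap into \<beta> q (1 - lap) and -\<beta> q isolates the
  deterministic drift; the first, nonnegative part belongs to \<open>gain\<close>.\<close>

lemma lap_eq: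
  assumes t: "0 \<le> t" and q: "0 < q"
  shows "lap t q = exp (- q * x0) - q * integral {0..t} \<beta> + integral {0..t} (\<lambda>s. gain s q)"
proof -
  have sub: "at s within {0..t} \<le> at s within {0..}" for s by (rule at_le) auto
  have "((\<lambda>s. gain s q - q * \<beta> s) has_integral lap t q - lap 0 q) {0..t}"
  proof (rule fundamental_theorem_of_calculus[OF t])
    fix s assume s: "s \<in> {0..t}"
    have "((\<lambda>t. lap t q) has_real_derivative gain s q - q * \<beta> s) (at s within {0..})"
      using lap_deriv[of s q] s q by (simp add: gain_def algebra_simps)
    then show "((\<lambda>t. lap t q) has_vector_derivative gain s q - q * \<beta> s) (at s within {0..t})"
      by (auto simp flip: has_real_derivative_iff_has_vector_derivative intro: DERIV_subset)
  qed
  moreover have "((\<lambda>s. gain s q - q * \<beta> s) has_integral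
      integral {0..t} (\<lambda>s. gain s q) - q * integral {0..t} \<beta>) {0..t}"
    by (intro has_integral_diff has_integral_mult_right integrable_integral integrable_continuous_real
        continuous_on_subset[OF gain_cont[OF q]] continuous_on_subset[OF \<beta>_cont]) auto
  ultimately have "lap t q - lap 0 q = integral {0..t} (\<lambda>s. gain s q) - q * integral {0..t} \<beta>"
    by (rule has_integral_unique)
  then show ?thesis by (simp add: lap_0)
qed

text \<open>Dropping the nonnegative integral of \<open>gain\<close> from \<open>lap_eq\<close> and
  using exp (-q x0) >= 1 - q x0 bounds the expectation of (1 - exp (-q X)) / q by the drift for
  every q > 0. Fatou's lemma along q = 1 / (n + 1) then reaches the mean.\<close>

lemma nn_integral_X_le:
  assumes t: "0 \<le> t"
  shows "(\<integral>\<^sup>+\<omega>. ennreal (X t \<omega>) \<partial>M) \<le> ennreal (drift t)"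
proof -
  define u where "u n \<omega> = real (Suc n) * (1 - exp (- (1 / real (Suc n)) * X t \<omega>))" for n \<omega>
  have u_lim: "(\<lambda>n. u n \<omega>) \<longlonglongrightarrow> X t \<omega>" for \<omega>
  proof -
    have "((\<lambda>h. exp (- h * X t \<omega>)) has_real_derivative - X t \<omega>) (at 0)"
      by (auto intro!: derivative_eq_intros)
    then have "((\<lambda>h. (exp (- h * X t \<omega>) - exp (- 0 * X t \<omega>)) / (h - 0)) \<longlongrightarrow> - X t \<omega>) (at 0)"
      by (simp only: has_field_derivative_iff)
    moreover have "filterlim (\<lambda>n. 1 / real (Suc n)) (at 0) sequentially"
      unfolding filterlim_at using LIMSEQ_Suc[OF lim_1_over_n[where 'a = real]] by (auto simp del: of_nat_Suc)
    ultimately have "(\<lambda>n. (exp (- (1 / real (Suc n)) * X t \<omega>) - exp (- 0 * X t \<omega>)) / (1 / real (Suc n) - 0)) \<longlonglongrightarrow> - X t \<omega>"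
      by (rule filterlim_compose)
    from tendsto_minus[OF this] show ?thesis by (simp add: u_def algebra_simps)
  qed
  have [measurable]: "X t \<in> borel_measurable M" by (rule X_measurable[OF t])
  have bound: "(\<integral>\<^sup>+\<omega>. ennreal (u n \<omega>) \<partial>M) \<le> ennreal (drift t)" for n
  proof -
    let ?q = "1 / real (Suc n)"
    have q: "0 < ?q" by simp
    have u_nonneg: "0 \<le> u n \<omega>" if "\<omega> \<in> space M" for \<omega>
      using X_nonneg[OF t that] by (auto simp: u_def)
    have "has_bochner_integral M (u n) (real (Suc n) * ((\<integral>\<omega>. 1 \<partial>M) - lap t ?q))"
      unfolding u_def lap_def using t q
      by (intro has_bochner_integral_mult_right has_bochner_integral_diff has_bochner_integral_integrable
          integrable_exp integrable_const) auto
    then have "integrable M (u n)" "(\<integral>\<omega>. u n \<omega> \<partial>M) = real (Suc n) * (1 - lap t ?q)"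
      by (auto simp: has_bochner_integral_iff prob_space)
    then have "(\<integral>\<^sup>+\<omega>. ennreal (u n \<omega>) \<partial>M) = ennreal (real (Suc n) * (1 - lap t ?q))"
      using u_nonneg by (subst nn_integral_eq_integral) auto
    also have "real (Suc n) * (1 - lap t ?q) \<le> real (Suc n) * (?q * drift t)"
    proof (rule mult_left_mono)
      have "0 \<le> integral {0..t} (\<lambda>s. gain s ?q)"
        using q by (intro integral_nonneg integrable_continuous_real continuous_on_subset[OF gain_cont[OF q]] gain_nonneg) auto
      then show "1 - lap t ?q \<le> ?q * drift t"
        unfolding lap_eq[OF t q] drift_def distrib_left using exp_ge_add_one_self[of "- ?q * x0"] by linarith
    qed simp
    also have "\<dots> = drift t" by simp
    finally show ?thesis by (auto intro: ennreal_leI)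
  qed
  have "(\<integral>\<^sup>+\<omega>. ennreal (X t \<omega>) \<partial>M) = (\<integral>\<^sup>+\<omega>. liminf (\<lambda>n. ennreal (u n \<omega>)) \<partial>M)"
    by (intro nn_integral_cong lim_imp_Liminf[symmetric] tendsto_ennrealI u_lim) simp
  also have "\<dots> \<le> liminf (\<lambda>n. \<integral>\<^sup>+\<omega>. ennreal (u n \<omega>) \<partial>M)"
    by (intro nn_integral_liminf) (simp add: u_def)
  also have "\<dots> \<le> limsup (\<lambda>n. \<integral>\<^sup>+\<omega>. ennreal (u n \<omega>) \<partial>M)"
    by (intro Liminf_le_Limsup) simp
  also have "\<dots> \<le> ennreal (drift t)"
    by (intro Limsup_bounded always_eventually allI bound)
  finally show ?thesis .
qed

lemma drift_nonneg: "0 \<le> t \<Longrightarrow> 0 \<le> drift t"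
  unfolding drift_def using x0 \<beta>_nonneg
  by (intro add_nonneg_nonneg integral_nonneg integrable_continuous_real continuous_on_subset[OF \<beta>_cont]) auto

lemma integrable_X:
  assumes "0 \<le> t" shows "integrable M (X t)" "(\<integral>\<omega>. X t \<omega> \<partial>M) \<le> drift t"
proof -
  show i: "integrable M (X t)"
    using nn_integral_X_le[OF assms] X_nonneg[OF assms] X_measurable[OF assms]
    by (intro integrableI_nonneg) (auto intro: le_less_trans)
  show "(\<integral>\<omega>. X t \<omega> \<partial>M) \<le> drift t"
    using nn_integral_X_le[OF assms] X_nonneg[OF assms] drift_nonneg[OF assms]
    by (subst (asm) nn_integral_eq_integral[OF i]) auto
qed

text \<open>The mean is multiplied by q > 0, so its upper bound suffices, and q times the integral
  of \<beta> in that bound cancels the same term in \<open>lap_eq\<close>. Only nonnegative terms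
  remain, ready for Tonelli.\<close>

lemma nn_integral_exp_remainder_le:
  assumes t: "0 \<le> t" and q: "0 < q"
  shows "(\<integral>\<^sup>+\<omega>. ennreal (exp (- q * X t \<omega>) - 1 + q * X t \<omega>) \<partial>M)
    \<le> ennreal (exp (- q * x0) - 1 + q * x0) + (\<integral>\<^sup>+s\<in>{0..t}. ennreal (gain s q) \<partial>lborel)"
proof -
  have nonneg: "0 \<le> exp (- q * y) - 1 + q * y" for y
    using exp_ge_add_one_self[of "- q * y"] by simp
  have "has_bochner_integral M (\<lambda>\<omega>. exp (- q * X t \<omega>) - 1 + q * X t \<omega>)
      (lap t q - (\<integral>\<omega>. 1 \<partial>M) + q * (\<integral>\<omega>. X t \<omega> \<partial>M))"
    unfolding lap_def using t q
    by (intro has_bochner_integral_mult_right has_bochner_integral_diff has_bochner_integral_add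
        has_bochner_integral_integrable integrable_exp integrable_X integrable_const) auto
  then have "(\<integral>\<^sup>+\<omega>. ennreal (exp (- q * X t \<omega>) - 1 + q * X t \<omega>) \<partial>M)
      = ennreal (lap t q - 1 + q * (\<integral>\<omega>. X t \<omega> \<partial>M))"
    using nonneg by (subst nn_integral_eq_integral) (auto simp: has_bochner_integral_iff prob_space)
  also have "\<dots> \<le> ennreal (exp (- q * x0) - 1 + q * x0 + integral {0..t} (\<lambda>s. gain s q))"
    using mult_left_mono[OF integrable_X(2)[OF t], of q] q
    by (intro ennreal_leI) (simp add: lap_eq[OF t q] drift_def algebra_simps)
  also have "\<dots> = ennreal (exp (- q * x0) - 1 + q * x0) + ennreal (integral {0..t} (\<lambda>s. gain s q))"
    using q by (intro ennreal_plus nonneg integral_nonneg integrable_continuous_real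
      continuous_on_subset[OF gain_cont[OF q]] gain_nonneg) auto
  also have "ennreal (integral {0..t} (\<lambda>s. gain s q)) = (\<integral>\<^sup>+s\<in>{0..t}. ennreal (gain s q) \<partial>lborel)"
    using q by (intro nn_integral_has_integral_lebesgue'[symmetric] integrable_integral
      integrable_continuous_real continuous_on_subset[OF gain_cont[OF q]] gain_nonneg) auto
  finally show ?thesis .
qed

end

section \<open>Moments\<close>

context nonneg_family
begin

text \<open>Extended nonnegative values, so that the Tonelli identities make sense before any moment
  of order above 1 is known to be finite.\<close>

definition mom :: "real \<Rightarrow> real \<Rightarrow> ennreal" where
  "mom t r = (\<integral>\<^sup>+\<omega>. ennreal (X t \<omega> powr r) \<partial>M)"

text \<open>For the summands of \<open>gain\<close> with \<open>lap_mom\<close>: under Tonelli, x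
  times the Gamma integral of exponent r is Gamma r x^(1-r). With r = alpha_i - p this is the origin
  of the order p + 1 - alpha_i and of the factor Gamma (alpha_i - p).\<close>

lemma nn_integral_powr_lap_mom:
  assumes t: "0 \<le> t" and r: "0 < r"
  shows "(\<integral>\<^sup>+q\<in>{0<..}. ennreal (q powr (r - 1) * lap_mom t q) \<partial>lborel) = ennreal (Gamma r) * mom t (1 - r)"
proof -
  interpret pair_sigma_finite M lborel ..
  have [measurable]: "X t \<in> borel_measurable M" by (rule X_measurable[OF t])
  have "(\<integral>\<^sup>+q\<in>{0<..}. ennreal (q powr (r - 1) * lap_mom t q) \<partial>lborel)
    = (\<integral>\<^sup>+q. \<integral>\<^sup>+\<omega>. ennreal (X t \<omega>) * (ennreal (q powr (r - 1) * exp (- q * X t \<omega>)) * indicator {0<..} q) \<partial>M \<partial>lborel)"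
  proof (intro nn_integral_cong)
    fix q :: real
    show "ennreal (q powr (r - 1) * lap_mom t q) * indicator {0<..} q
      = (\<integral>\<^sup>+\<omega>. ennreal (X t \<omega>) * (ennreal (q powr (r - 1) * exp (- q * X t \<omega>)) * indicator {0<..} q) \<partial>M)"
    proof (cases "0 < q")
      case True
      have "(\<integral>\<^sup>+\<omega>. ennreal (X t \<omega>) * (ennreal (q powr (r - 1) * exp (- q * X t \<omega>)) * indicator {0<..} q) \<partial>M)
        = (\<integral>\<^sup>+\<omega>. ennreal (q powr (r - 1)) * ennreal (X t \<omega> * exp (- q * X t \<omega>)) \<partial>M)"
        using True X_nonneg[OF t] by (intro nn_integral_cong) (simp add: ennreal_mult'[symmetric] mult_ac)
      also have "\<dots> = ennreal (q powr (r - 1)) * (\<integral>\<^sup>+\<omega>. ennreal (X t \<omega> * exp (- q * X t \<omega>)) \<partial>M)"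
        by (rule nn_integral_cmult) measurable
      also have "(\<integral>\<^sup>+\<omega>. ennreal (X t \<omega> * exp (- q * X t \<omega>)) \<partial>M) = ennreal (lap_mom t q)"
        unfolding lap_mom_def using X_nonneg[OF t]
        by (intro nn_integral_eq_integral integrable_mult_exp t True AE_I2) simp
      finally show ?thesis using True by (simp add: ennreal_mult')
    qed simp
  qed
  also have "\<dots> = (\<integral>\<^sup>+\<omega>. \<integral>\<^sup>+q. ennreal (X t \<omega>) * (ennreal (q powr (r - 1) * exp (- q * X t \<omega>)) * indicator {0<..} q) \<partial>lborel \<partial>M)"
    by (rule Fubini') measurable
  also have "\<dots> = (\<integral>\<^sup>+\<omega>. ennreal (Gamma r) * ennreal (X t \<omega> powr (1 - r)) \<partial>M)"
  proof (rule nn_integral_cong)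
    fix \<omega> assume \<omega>: "\<omega> \<in> space M"
    have "(\<integral>\<^sup>+q. ennreal (X t \<omega>) * (ennreal (q powr (r - 1) * exp (- q * X t \<omega>)) * indicator {0<..} q) \<partial>lborel)
      = ennreal (X t \<omega>) * (\<integral>\<^sup>+q\<in>{0<..}. ennreal (q powr (r - 1) * exp (- q * X t \<omega>)) \<partial>lborel)"
      by (rule nn_integral_cmult) measurable
    also have "\<dots> = ennreal (Gamma r) * ennreal (X t \<omega> powr (1 - r))"
    \<comment> \<open>If the value is 0, the Gamma integral is infinite, but 0 times infinity is 0
      in \<open>ennreal\<close>, and \<open>0 powr (1 - r)\<close> is 0 on the right.\<close>
    proof (cases "X t \<omega> = 0")
      case False
      then have pos: "0 < X t \<omega>" using X_nonneg[OF t \<omega>] by simp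
      then show ?thesis
        using r by (simp only: nn_integral_Gamma_scaled) (simp add: ennreal_mult'[symmetric] powr_diff powr_minus field_simps)
    qed simp
    finally show "(\<integral>\<^sup>+q. ennreal (X t \<omega>) * (ennreal (q powr (r - 1) * exp (- q * X t \<omega>)) * indicator {0<..} q) \<partial>lborel)
      = ennreal (Gamma r) * ennreal (X t \<omega> powr (1 - r))" .
  qed
  also have "\<dots> = ennreal (Gamma r) * mom t (1 - r)"
    unfolding mom_def by (rule nn_integral_cmult) measurable
  finally show ?thesis .
qed

text \<open>For the summand of \<open>gain\<close> with \<beta>, after its factor q has been merged
  with the weight q^(-1-p). It is the origin of the order p - 1.\<close>

lemma nn_integral_powr_one_minus_lap:
  assumes t: "0 \<le> t" and p: "1 < p" "p < 2"
  shows "(\<integral>\<^sup>+q\<in>{0<..}. ennreal (q powr (- p) * (1 - lap t q)) \<partial>lborel) = ennreal (Gamma (2 - p) / (p - 1)) * mom t (p - 1)"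
proof -
  interpret pair_sigma_finite M lborel ..
  have [measurable]: "X t \<in> borel_measurable M" by (rule X_measurable[OF t])
  have "(\<integral>\<^sup>+q\<in>{0<..}. ennreal (q powr (- p) * (1 - lap t q)) \<partial>lborel)
    = (\<integral>\<^sup>+q. \<integral>\<^sup>+\<omega>. ennreal ((1 - exp (- q * X t \<omega>)) * q powr (- p)) * indicator {0<..} q \<partial>M \<partial>lborel)"
  proof (intro nn_integral_cong)
    fix q :: real
    show "ennreal (q powr (- p) * (1 - lap t q)) * indicator {0<..} q
      = (\<integral>\<^sup>+\<omega>. ennreal ((1 - exp (- q * X t \<omega>)) * q powr (- p)) * indicator {0<..} q \<partial>M)"
    proof (cases "0 < q")
      case True
      have "has_bochner_integral M (\<lambda>\<omega>. (1 - exp (- q * X t \<omega>)) * q powr (- p)) (((\<integral>\<omega>. 1 \<partial>M) - lap t q) * q powr (- p))"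
        unfolding lap_def using t True
        by (intro has_bochner_integral_mult_left has_bochner_integral_diff has_bochner_integral_integrable
            integrable_exp integrable_const) auto
      then have "(\<integral>\<^sup>+\<omega>. ennreal ((1 - exp (- q * X t \<omega>)) * q powr (- p)) \<partial>M) = ennreal ((1 - lap t q) * q powr (- p))"
        using X_nonneg[OF t] True
        by (subst nn_integral_eq_integral) (auto simp: has_bochner_integral_iff prob_space)
      then show ?thesis using True by (simp add: mult.commute)
    qed simp
  qed
  also have "\<dots> = (\<integral>\<^sup>+\<omega>. \<integral>\<^sup>+q. ennreal ((1 - exp (- q * X t \<omega>)) * q powr (- p)) * indicator {0<..} q \<partial>lborel \<partial>M)"
    by (rule Fubini') measurable
  also have "\<dots> = (\<integral>\<^sup>+\<omega>. ennreal (Gamma (2 - p) / (p - 1)) * ennreal (X t \<omega> powr (p - 1)) \<partial>M)"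
  proof (rule nn_integral_cong)
    fix \<omega> assume \<omega>: "\<omega> \<in> space M"
    show "(\<integral>\<^sup>+q. ennreal ((1 - exp (- q * X t \<omega>)) * q powr (- p)) * indicator {0<..} q \<partial>lborel)
      = ennreal (Gamma (2 - p) / (p - 1)) * ennreal (X t \<omega> powr (p - 1))"
      unfolding nn_integral_one_minus_exp_powr[OF p X_nonneg[OF t \<omega>]] by (rule ennreal_mult'') simp
  qed
  also have "\<dots> = ennreal (Gamma (2 - p) / (p - 1)) * mom t (p - 1)"
    unfolding mom_def by (rule nn_integral_cmult) measurable
  finally show ?thesis .
qed

text \<open>The left-hand side of the moment inequality. The inner expectation stays a nonnegative
  integral so that the bound for fixed q can be inserted under the integral in q.\<close>

lemma nn_integral_powr_exp_remainder:
  assumes t: "0 \<le> t" and p: "1 < p" "p < 2"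
  shows "(\<integral>\<^sup>+q\<in>{0<..}. ennreal (q powr (- 1 - p)) * (\<integral>\<^sup>+\<omega>. ennreal (exp (- q * X t \<omega>) - 1 + q * X t \<omega>) \<partial>M) \<partial>lborel)
    = ennreal (Gamma (2 - p) / (p * (p - 1))) * mom t p"
proof -
  interpret pair_sigma_finite M lborel ..
  have [measurable]: "X t \<in> borel_measurable M" by (rule X_measurable[OF t])
  have "(\<integral>\<^sup>+q\<in>{0<..}. ennreal (q powr (- 1 - p)) * (\<integral>\<^sup>+\<omega>. ennreal (exp (- q * X t \<omega>) - 1 + q * X t \<omega>) \<partial>M) \<partial>lborel)
    = (\<integral>\<^sup>+q. \<integral>\<^sup>+\<omega>. ennreal ((exp (- q * X t \<omega>) - 1 + q * X t \<omega>) * q powr (- 1 - p)) * indicator {0<..} q \<partial>M \<partial>lborel)"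
    by (intro nn_integral_cong)
      (simp add: nn_integral_cmult[symmetric] nn_integral_multc[symmetric] ennreal_mult' ennreal_mult'' mult_ac)
  also have "\<dots> = (\<integral>\<^sup>+\<omega>. \<integral>\<^sup>+q. ennreal ((exp (- q * X t \<omega>) - 1 + q * X t \<omega>) * q powr (- 1 - p)) * indicator {0<..} q \<partial>lborel \<partial>M)"
    by (rule Fubini') measurable
  also have "\<dots> = (\<integral>\<^sup>+\<omega>. ennreal (Gamma (2 - p) / (p * (p - 1))) * ennreal (X t \<omega> powr p) \<partial>M)"
  proof (rule nn_integral_cong)
    fix \<omega> assume \<omega>: "\<omega> \<in> space M"
    show "(\<integral>\<^sup>+q. ennreal ((exp (- q * X t \<omega>) - 1 + q * X t \<omega>) * q powr (- 1 - p)) * indicator {0<..} q \<partial>lborel)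
      = ennreal (Gamma (2 - p) / (p * (p - 1))) * ennreal (X t \<omega> powr p)"
      unfolding nn_integral_exp_remainder_powr[OF p X_nonneg[OF t \<omega>]] by (rule ennreal_mult'') simp
  qed
  also have "\<dots> = ennreal (Gamma (2 - p) / (p * (p - 1))) * mom t p"
    unfolding mom_def by (rule nn_integral_cmult) measurable
  finally show ?thesis .
qed

text \<open>Jensen's inequality through tangents: with \<theta> = r / p, the concave y^\<theta> lies
  below its tangent at any m > 0, here by Young's inequality, and integrating at y = x^p needs
  nothing but the bound n. The tangent point m = n gives the claim, but n = 0 has to be approached
  from above, hence the slack e.\<close>

lemma mom_le_powr:
  assumes t: "0 \<le> t" and r: "0 < r" "r < p" and n: "0 \<le> n" and mom: "mom t p \<le> ennreal n"
  shows "mom t r \<le> ennreal (n powr (r / p))"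
proof (rule ennreal_le_epsilon)
  fix e :: real assume e: "0 < e"
  have [measurable]: "X t \<in> borel_measurable M" by (rule X_measurable[OF t])
  have p: "0 < p" using r by simp
  define \<theta> where "\<theta> = r / p"
  have \<theta>: "0 < \<theta>" "\<theta> < 1" using r p by (auto simp: \<theta>_def)
  have young: "ennreal (X t \<omega> powr r) \<le> ennreal (\<theta> * m powr (\<theta> - 1)) * ennreal (X t \<omega> powr p) + ennreal ((1 - \<theta>) * m powr \<theta>)"
    if m: "0 < m" for m \<omega>
  proof (cases "X t \<omega> = 0")
    case False
    have "(X t \<omega> powr p) powr \<theta> * m powr (1 - \<theta>) \<le> \<theta> * X t \<omega> powr p + (1 - \<theta>) * m"
      using \<theta> m False by (intro Youngs_inequality_0) auto
    then have "(X t \<omega> powr p) powr \<theta> * m powr (1 - \<theta>) * m powr (\<theta> - 1) \<le> (\<theta> * X t \<omega> powr p + (1 - \<theta>) * m) * m powr (\<theta> - 1)"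
      by (intro mult_right_mono) auto
    also have "(X t \<omega> powr p) powr \<theta> * m powr (1 - \<theta>) * m powr (\<theta> - 1) = X t \<omega> powr r"
      using m p by (simp add: powr_powr \<theta>_def mult.assoc flip: powr_add)
    also have "(\<theta> * X t \<omega> powr p + (1 - \<theta>) * m) * m powr (\<theta> - 1) = \<theta> * m powr (\<theta> - 1) * X t \<omega> powr p + (1 - \<theta>) * m powr \<theta>"
      using m by (simp add: powr_diff field_simps)
    finally show ?thesis
      using \<theta> by (simp add: ennreal_leI flip: ennreal_plus ennreal_mult)
  qed simp
  have bound: "mom t r \<le> ennreal (m powr \<theta>)" if m: "0 < m" "n \<le> m" for m
  proof -
    have "mom t r \<le> (\<integral>\<^sup>+\<omega>. ennreal (\<theta> * m powr (\<theta> - 1)) * ennreal (X t \<omega> powr p) + ennreal ((1 - \<theta>) * m powr \<theta>) \<partial>M)"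
      unfolding mom_def by (intro nn_integral_mono young m)
    also have "\<dots> = ennreal (\<theta> * m powr (\<theta> - 1)) * mom t p + ennreal ((1 - \<theta>) * m powr \<theta>)"
      unfolding mom_def by (simp add: nn_integral_add nn_integral_cmult emeasure_space_1)
    also have "\<dots> \<le> ennreal (\<theta> * m powr (\<theta> - 1)) * ennreal m + ennreal ((1 - \<theta>) * m powr \<theta>)"
      using m by (intro add_right_mono mult_left_mono order_trans[OF mom] ennreal_leI) auto
    also have "\<dots> = ennreal (m powr \<theta>)"
      using m \<theta> by (simp add: powr_diff field_simps flip: ennreal_plus ennreal_mult)
    finally show ?thesis .
  qed
  \<comment> \<open>For n = 0 the point m = e^(1/\<theta>) makes m^\<theta> equal to the permitted
    slack e.\<close>
  obtain m where m: "0 < m" "n \<le> m" "m powr \<theta> \<le> n powr \<theta> + e"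
  proof (cases "n = 0")
    case True
    have "(e powr (1 / \<theta>)) powr \<theta> = e" using e \<theta> by (simp add: powr_powr)
    then show thesis using that[of "e powr (1 / \<theta>)"] True e by simp
  next
    case False
    then show thesis using that[of n] n e by simp
  qed
  have "mom t r \<le> ennreal (n powr \<theta> + e)" using bound[OF m(1,2)] m(3) by (meson ennreal_leI order_trans)
  then show "mom t r \<le> ennreal (n powr (r / p)) + ennreal e"
    using e by (simp add: \<theta>_def ennreal_plus)
qed

end

lemma powr_le_one_plus:
  fixes y :: real
  assumes "0 \<le> y" "0 < \<theta>" "\<theta> \<le> 1"
  shows "y powr \<theta> \<le> 1 + y"
proof (cases "y \<le> 1")
  case True
  then have "y powr \<theta> \<le> 1" using assms by (simp add: powr_le1)
  then show ?thesis using assms by linarith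
next
  case False
  then have "y powr \<theta> \<le> y powr 1" using assms by (intro powr_mono) auto
  then show ?thesis using assms by simp
qed

section \<open>The moment inequality from the integrated gain\<close>

context laplace_flow
begin

text \<open>The indicator makes the integrand jointly measurable on the whole plane; nothing is known about
  \<open>gain\<close> at negative times.\<close>

definition flux :: "real \<Rightarrow> real \<Rightarrow> ennreal" where
  "flux p s = (\<integral>\<^sup>+q. ennreal (q powr (- 1 - p) * (indicator ({0..} \<times> {0<..}) (s, q) * gain s q)) \<partial>lborel)"

lemma flux_integrand_measurable:
  "(\<lambda>(s, q). ennreal (q powr (- 1 - p) * (indicator ({0..} \<times> {0<..}) (s, q) * gain s q)))
    \<in> borel_measurable (lborel \<Otimes>\<^sub>M lborel)"
proof -
  have [measurable]: "(\<lambda>x. indicator ({0..} \<times> {0<..}) x * gain (fst x) (snd x)) \<in> borel_measurable (lborel \<Otimes>\<^sub>M lborel)"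
    using gain_measurable by (simp cong: measurable_cong_sets sets_pair_measure_cong)
  have "(\<lambda>x. ennreal (snd x powr (- 1 - p) * (indicator ({0..} \<times> {0<..}) x * gain (fst x) (snd x))))
    \<in> borel_measurable (lborel \<Otimes>\<^sub>M lborel)" by measurable
  then show ?thesis by (simp add: case_prod_unfold)
qed

lemma flux_measurable [measurable]: "flux p \<in> borel_measurable borel"
  using lborel.borel_measurable_nn_integral[OF flux_integrand_measurable, of p]
  by (simp add: flux_def[abs_def])

text \<open>The weight turns q^alpha_i into q^((alpha_i - p) - 1), with a positive Gamma exponent
  because p < alpha_i, and q into q^(-p). All summands are nonnegative, so the integral splits
  without any finiteness.\<close>

lemma flux_eq:
  assumes s: "0 \<le> s" and p: "1 < p" "p < 2" and \<alpha>: "\<And>i. i \<in> A \<Longrightarrow> p < \<alpha> i"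
  shows "flux p s = (\<Sum>i\<in>A. ennreal (k i s * Gamma (\<alpha> i - p)) * mom s (p + 1 - \<alpha> i))
    + ennreal (\<beta> s * (Gamma (2 - p) / (p - 1))) * mom s (p - 1)"
proof -
  have X[measurable]: "X s \<in> borel_measurable M" by (rule X_measurable[OF s])
  have [measurable]: "lap s \<in> borel_measurable borel" "lap_mom s \<in> borel_measurable borel"
    unfolding lap_def[abs_def] lap_mom_def[abs_def] by measurable
  have "flux p s = (\<integral>\<^sup>+q. (\<Sum>i\<in>A. ennreal (k i s) * (ennreal (q powr ((\<alpha> i - p) - 1) * lap_mom s q) * indicator {0<..} q))
      + ennreal (\<beta> s) * (ennreal (q powr (- p) * (1 - lap s q)) * indicator {0<..} q) \<partial>lborel)"
    unfolding flux_def
  proof (intro nn_integral_cong)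
    fix q :: real
    show "ennreal (q powr (- 1 - p) * (indicator ({0..} \<times> {0<..}) (s, q) * gain s q))
      = (\<Sum>i\<in>A. ennreal (k i s) * (ennreal (q powr ((\<alpha> i - p) - 1) * lap_mom s q) * indicator {0<..} q))
      + ennreal (\<beta> s) * (ennreal (q powr (- p) * (1 - lap s q)) * indicator {0<..} q)"
    proof (cases "0 < q")
      case True
      have L: "0 \<le> lap_mom s q" "0 \<le> 1 - lap s q" using lap_mom_bounds[OF s True] lap_bounds[of s q] s True by auto
      have pw: "q powr (- 1 - p) * q powr \<alpha> i = q powr ((\<alpha> i - p) - 1)" for i
        unfolding powr_add[symmetric] by (simp add: algebra_simps)
      have "q powr (- 1 - p) * q powr 1 = q powr (- p)"
        unfolding powr_add[symmetric] by simp
      then have pw': "q powr (- 1 - p) * q = q powr (- p)" using True by simp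
      have nn: "0 \<le> k i s * (q powr ((\<alpha> i - p) - 1) * lap_mom s q)" if "i \<in> A" for i
        by (intro mult_nonneg_nonneg k_nonneg that s L) simp
      have nn': "0 \<le> \<beta> s * (q powr (- p) * (1 - lap s q))"
        by (intro mult_nonneg_nonneg \<beta>_nonneg s L) simp
      have "q powr (- 1 - p) * (indicator ({0..} \<times> {0<..}) (s, q) * gain s q)
        = (\<Sum>i\<in>A. k i s * ((q powr (- 1 - p) * q powr \<alpha> i) * lap_mom s q)) + \<beta> s * ((q powr (- 1 - p) * q) * (1 - lap s q))"
        using True s by (simp add: gain_def distrib_left sum_distrib_left sum_distrib_right mult_ac)
      then have "ennreal (q powr (- 1 - p) * (indicator ({0..} \<times> {0<..}) (s, q) * gain s q))
        = ennreal ((\<Sum>i\<in>A. k i s * (q powr ((\<alpha> i - p) - 1) * lap_mom s q)) + \<beta> s * (q powr (- p) * (1 - lap s q)))"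
        by (simp only: pw pw')
      also have "\<dots> = (\<Sum>i\<in>A. ennreal (k i s * (q powr ((\<alpha> i - p) - 1) * lap_mom s q)))
          + ennreal (\<beta> s * (q powr (- p) * (1 - lap s q)))"
        by (simp only: ennreal_plus[OF sum_nonneg[OF nn] nn'] sum_ennreal[OF nn])
      also have "(\<Sum>i\<in>A. ennreal (k i s * (q powr ((\<alpha> i - p) - 1) * lap_mom s q)))
          = (\<Sum>i\<in>A. ennreal (k i s) * ennreal (q powr ((\<alpha> i - p) - 1) * lap_mom s q))"
        by (rule sum.cong[OF refl ennreal_mult'[OF k_nonneg[OF _ s]]])
      also have "ennreal (\<beta> s * (q powr (- p) * (1 - lap s q))) = ennreal (\<beta> s) * ennreal (q powr (- p) * (1 - lap s q))"
        by (rule ennreal_mult'[OF \<beta>_nonneg[OF s]])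
      finally show ?thesis using True by simp
    qed simp
  qed
  also have "\<dots> = (\<Sum>i\<in>A. ennreal (k i s) * (\<integral>\<^sup>+q\<in>{0<..}. ennreal (q powr ((\<alpha> i - p) - 1) * lap_mom s q) \<partial>lborel))
      + ennreal (\<beta> s) * (\<integral>\<^sup>+q\<in>{0<..}. ennreal (q powr (- p) * (1 - lap s q)) \<partial>lborel)"
    by (simp add: nn_integral_add nn_integral_sum nn_integral_cmult)
  also have "\<dots> = (\<Sum>i\<in>A. ennreal (k i s * Gamma (\<alpha> i - p)) * mom s (p + 1 - \<alpha> i))
    + ennreal (\<beta> s * (Gamma (2 - p) / (p - 1))) * mom s (p - 1)"
  proof (intro arg_cong2[where f = "(+)"] sum.cong refl)
    fix i assume i: "i \<in> A"
    show "ennreal (k i s) * (\<integral>\<^sup>+q\<in>{0<..}. ennreal (q powr ((\<alpha> i - p) - 1) * lap_mom s q) \<partial>lborel)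
      = ennreal (k i s * Gamma (\<alpha> i - p)) * mom s (p + 1 - \<alpha> i)"
      using nn_integral_powr_lap_mom[OF s, of "\<alpha> i - p"] \<alpha>[OF i] k_nonneg[OF i s]
      by (simp add: ennreal_mult' mult.assoc diff_diff_eq2 add.commute)
  next
    show "ennreal (\<beta> s) * (\<integral>\<^sup>+q\<in>{0<..}. ennreal (q powr (- p) * (1 - lap s q)) \<partial>lborel)
      = ennreal (\<beta> s * (Gamma (2 - p) / (p - 1))) * mom s (p - 1)"
      using nn_integral_powr_one_minus_lap[OF s p] \<beta>_nonneg[OF s]
      by (simp only: ennreal_mult' mult.assoc)
  qed
  finally show ?thesis .
qed

lemma mom_le_flux:
  assumes t: "0 \<le> t" and p: "1 < p" "p < 2"
  shows "mom t p \<le> ennreal (x0 powr p) + (\<integral>\<^sup>+s\<in>{0..t}. ennreal (p * (p - 1) / Gamma (2 - p)) * flux p s \<partial>lborel)"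
proof -
  \<comment> \<open>\<open>?c\<close> is the constant in the integral representation of x^p; its
    reciprocal \<open>?C\<close> is the common factor of the coefficients of the differential
    equation.\<close>
  let ?c = "Gamma (2 - p) / (p * (p - 1))" and ?C = "p * (p - 1) / Gamma (2 - p)"
  let ?h = "\<lambda>s q. ennreal (q powr (- 1 - p) * (indicator ({0..} \<times> {0<..}) (s, q) * gain s q)) * indicator {0..t} s"
  have \<Gamma>: "0 < Gamma (2 - p)" using p by (intro Gamma_real_pos) simp
  have c: "0 < ?c" "?C * ?c = 1" "0 \<le> ?C"
    using p \<Gamma> less_imp_neq[OF \<Gamma>] by (auto intro!: divide_pos_pos)
  have h_meas: "case_prod ?h \<in> borel_measurable (lborel \<Otimes>\<^sub>M lborel)"
  proof -
    note [measurable] = flux_integrand_measurable[of p]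
    have "(\<lambda>x. (case x of (s, q) \<Rightarrow> ennreal (q powr (- 1 - p) * (indicator ({0..} \<times> {0<..}) (s, q) * gain s q)))
      * indicator {0..t} (fst x)) \<in> borel_measurable (lborel \<Otimes>\<^sub>M lborel)" by measurable
    then show ?thesis by (simp add: case_prod_unfold)
  qed
  have h_meas': "(\<lambda>(q, s). ?h s q) \<in> borel_measurable (lborel \<Otimes>\<^sub>M lborel)"
    using measurable_pair_swap[OF h_meas] by (simp only: prod.case)
  have nonneg: "0 \<le> exp (- q * y) - 1 + q * y" for q y :: real
    using exp_ge_add_one_self[of "- q * y"] by simp
  have "ennreal ?c * mom t p = (\<integral>\<^sup>+q\<in>{0<..}. ennreal (q powr (- 1 - p)) * (\<integral>\<^sup>+\<omega>. ennreal (exp (- q * X t \<omega>) - 1 + q * X t \<omega>) \<partial>M) \<partial>lborel)"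
    by (rule nn_integral_powr_exp_remainder[OF t p, symmetric])
  also have "\<dots> \<le> (\<integral>\<^sup>+q. ennreal ((exp (- q * x0) - 1 + q * x0) * q powr (- 1 - p)) * indicator {0<..} q + (\<integral>\<^sup>+s. ?h s q \<partial>lborel) \<partial>lborel)"
  proof (rule nn_integral_mono)
    fix q :: real
    show "ennreal (q powr (- 1 - p)) * (\<integral>\<^sup>+\<omega>. ennreal (exp (- q * X t \<omega>) - 1 + q * X t \<omega>) \<partial>M) * indicator {0<..} q
      \<le> ennreal ((exp (- q * x0) - 1 + q * x0) * q powr (- 1 - p)) * indicator {0<..} q + (\<integral>\<^sup>+s. ?h s q \<partial>lborel)"
    proof (cases "0 < q")
      case True
      have "(\<lambda>s. ennreal (gain s q) * indicator {0..t} s) \<in> borel_measurable lborel"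
      proof -
        have "(\<lambda>s. indicator {0..t} s *\<^sub>R gain s q) \<in> borel_measurable borel"
          by (intro borel_measurable_continuous_on_indicator continuous_on_subset[OF gain_cont[OF True]]) auto
        then have "(\<lambda>s. ennreal (indicator {0..t} s *\<^sub>R gain s q)) \<in> borel_measurable lborel" by measurable
        then show ?thesis by (rule measurable_cong[THEN iffD1, rotated]) (auto split: split_indicator)
      qed
      then have "(\<integral>\<^sup>+s. ?h s q \<partial>lborel) = ennreal (q powr (- 1 - p)) * (\<integral>\<^sup>+s\<in>{0..t}. ennreal (gain s q) \<partial>lborel)"
        using True by (subst nn_integral_cmult[symmetric])
          (auto intro!: nn_integral_cong simp: ennreal_mult' split: split_indicator)
      moreover have "ennreal ((exp (- q * x0) - 1 + q * x0) * q powr (- 1 - p))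
          = ennreal (q powr (- 1 - p)) * ennreal (exp (- q * x0) - 1 + q * x0)"
        by (subst mult.commute, rule ennreal_mult') simp
      ultimately show ?thesis
        using mult_left_mono[OF nn_integral_exp_remainder_le[OF t True], of "ennreal (q powr (- 1 - p))", unfolded distrib_left] True
        by simp
    qed simp
  qed
  also have "\<dots> = (\<integral>\<^sup>+q\<in>{0<..}. ennreal ((exp (- q * x0) - 1 + q * x0) * q powr (- 1 - p)) \<partial>lborel)
      + (\<integral>\<^sup>+q. \<integral>\<^sup>+s. ?h s q \<partial>lborel \<partial>lborel)"
    by (rule nn_integral_add[OF _ lborel.borel_measurable_nn_integral[OF h_meas']]) measurable
  also have "(\<integral>\<^sup>+q. \<integral>\<^sup>+s. ?h s q \<partial>lborel \<partial>lborel) = (\<integral>\<^sup>+s\<in>{0..t}. flux p s \<partial>lborel)"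
    unfolding lborel_pair.Fubini'[OF h_meas]
  proof (intro nn_integral_cong)
    fix s :: real
    show "(\<integral>\<^sup>+q. ?h s q \<partial>lborel) = flux p s * indicator {0..t} s"
      by (cases "s \<in> {0..t}") (simp_all add: flux_def)
  qed
  also have "(\<integral>\<^sup>+q\<in>{0<..}. ennreal ((exp (- q * x0) - 1 + q * x0) * q powr (- 1 - p)) \<partial>lborel) = ennreal (?c * x0 powr p)"
    by (rule nn_integral_exp_remainder_powr[OF p x0])
  finally have "ennreal ?C * (ennreal ?c * mom t p) \<le> ennreal ?C * (ennreal (?c * x0 powr p) + (\<integral>\<^sup>+s\<in>{0..t}. flux p s \<partial>lborel))"
    by (rule mult_left_mono) simp
  moreover have "ennreal ?C * (ennreal ?c * z) = z" for z
  proof -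
    have "ennreal ?C * ennreal ?c = 1" unfolding ennreal_mult'[OF c(3), symmetric] c(2) by simp
    then show ?thesis by (simp flip: mult.assoc)
  qed
  moreover have "ennreal (?c * x0 powr p) = ennreal ?c * ennreal (x0 powr p)"
    by (rule ennreal_mult'') simp
  ultimately show ?thesis
    by (simp only: distrib_left mult.assoc) (simp add: nn_integral_cmult mult.assoc)
qed

end

section \<open>A priori bounds and the closed integral inequality\<close>

context laplace_flow
begin

lemma drift_cont: "continuous_on {0..} drift"
  unfolding drift_def[abs_def]
  by (intro continuous_on_indefinite_integral integrable_continuous_real continuous_on_subset[OF \<beta>_cont]) auto

text \<open>The orders occurring in \<open>flux\<close> lie below 1, so the mean dominates those
  moments by a continuous function of time. This rules out an infinite flux, under which the moment
  inequality would say nothing.\<close>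

lemma mom_le_drift:
  assumes t: "0 \<le> t" and r: "0 < r" "r \<le> 1"
  shows "mom t r \<le> ennreal (1 + drift t)"
proof -
  have [measurable]: "X t \<in> borel_measurable M" by (rule X_measurable[OF t])
  have "mom t r \<le> (\<integral>\<^sup>+\<omega>. 1 + ennreal (X t \<omega>) \<partial>M)"
    unfolding mom_def
  proof (rule nn_integral_mono)
    fix \<omega> assume \<omega>: "\<omega> \<in> space M"
    have "ennreal (X t \<omega> powr r) \<le> ennreal (1 + X t \<omega>)"
      by (intro ennreal_leI powr_le_one_plus X_nonneg[OF t \<omega>] r)
    then show "ennreal (X t \<omega> powr r) \<le> 1 + ennreal (X t \<omega>)"
      using X_nonneg[OF t \<omega>] by simp
  qed
  also have "\<dots> = 1 + (\<integral>\<^sup>+\<omega>. ennreal (X t \<omega>) \<partial>M)"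
    by (simp add: nn_integral_add emeasure_space_1)
  also have "\<dots> \<le> 1 + ennreal (drift t)"
    by (intro add_left_mono nn_integral_X_le t)
  finally show ?thesis using drift_nonneg[OF t] by simp
qed

lemma moment_ode_solution:
  assumes p: "1 < p" "p < 2" and \<alpha>: "\<And>i. i \<in> A \<Longrightarrow> p < \<alpha> i \<and> \<alpha> i \<le> 2"
  obtains I where "I 0 = x0 powr p" "\<And>t. 0 \<le> t \<Longrightarrow> 0 \<le> I t"
    "\<And>t. 0 \<le> t \<Longrightarrow> (I has_real_derivative p * \<beta> t * I t powr ((p - 1) / p)
      + (\<Sum>i\<in>A. p * (p - 1) / Gamma (2 - p) * Gamma (\<alpha> i - p) * k i t * I t powr ((p + 1 - \<alpha> i) / p))) (at t within {0..})"
    "\<And>t. 0 \<le> t \<Longrightarrow> mom t p \<le> ennreal (I t)"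
proof -
  let ?C = "p * (p - 1) / Gamma (2 - p)"
  define h where "h i s = ?C * Gamma (\<alpha> i - p) * k i s" for i s
  define F where "F s y = p * \<beta> s * y powr ((p - 1) / p) + (\<Sum>i\<in>A. h i s * y powr ((p + 1 - \<alpha> i) / p))" for s y
  have \<Gamma>: "0 < Gamma (2 - p)" using p by (intro Gamma_real_pos) simp
  have C: "0 \<le> ?C" using p \<Gamma> by (intro divide_nonneg_pos mult_nonneg_nonneg) auto
  have h_nonneg: "0 \<le> h i s" if "i \<in> A" "0 \<le> s" for i s
    unfolding h_def using \<alpha>[OF that(1)] k_nonneg[OF that]
    by (intro mult_nonneg_nonneg C less_imp_le[OF Gamma_real_pos]) auto
  have h_cont: "continuous_on {0..} (h i)" if "i \<in> A" for i
    unfolding h_def[abs_def] by (intro continuous_intros k_cont that)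
  have p\<beta>_nonneg: "0 \<le> p * \<beta> s" if "0 \<le> s" for s using p \<beta>_nonneg[OF that] by simp
  \<comment> \<open>Positivity rests on p > 1 and \<alpha> i <= 2, the bound by 1 on p < \<alpha> i.
    Positive exponents give continuity and monotonicity of the right-hand side, exponents below 1
    its linear growth.\<close>
  have exps: "0 < (p - 1) / p" "(p - 1) / p < 1" "0 < p + 1 - \<alpha> i" "p + 1 - \<alpha> i < 1" "p + 1 - \<alpha> i < p"
    "0 < (p + 1 - \<alpha> i) / p" "(p + 1 - \<alpha> i) / p < 1" if "i \<in> A" for i
    using p \<alpha>[OF that] by (auto simp: divide_simps)
  have exp0: "0 < (p - 1) / p" "(p - 1) / p < 1" using p by (auto simp: divide_simps)
  have Cflux: "ennreal ?C * flux p s = (\<Sum>i\<in>A. ennreal (h i s) * mom s (p + 1 - \<alpha> i)) + ennreal (p * \<beta> s) * mom s (p - 1)"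
    if s: "0 \<le> s" for s
  proof -
    \<comment> \<open>The two constants meet: p (p - 1) / Gamma (2 - p) times Gamma (2 - p) / (p -
      1) leaves the factor p of the immigration term.\<close>
    have "ennreal ?C * ennreal (\<beta> s * (Gamma (2 - p) / (p - 1))) = ennreal (p * \<beta> s)"
    proof -
      have "?C * (\<beta> s * (Gamma (2 - p) / (p - 1))) = p * \<beta> s"
        using p less_imp_neq[OF \<Gamma>] by (simp add: field_simps)
      then show ?thesis by (simp only: ennreal_mult'[OF C, symmetric])
    qed
    moreover have "ennreal ?C * ennreal (k i s * Gamma (\<alpha> i - p)) = ennreal (h i s)" for i
      unfolding h_def ennreal_mult'[OF C, symmetric] by (simp only: mult_ac)
    ultimately show ?thesis
      using flux_eq[OF s p] \<alpha> by (simp only: distrib_left sum_distrib_left mult.assoc[symmetric])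
  qed
  define G where "G s = ((\<Sum>i\<in>A. h i s) + p * \<beta> s) * (1 + drift s)" for s
  have flux_le_G: "ennreal ?C * flux p s \<le> ennreal (G s)" if s: "0 \<le> s" for s
  proof -
    have "ennreal ?C * flux p s \<le> (\<Sum>i\<in>A. ennreal (h i s) * ennreal (1 + drift s)) + ennreal (p * \<beta> s) * ennreal (1 + drift s)"
      unfolding Cflux[OF s] using exps p
      by (intro add_mono sum_mono mult_left_mono mom_le_drift s) (auto intro: less_imp_le)
    also have "\<dots> = ennreal (\<Sum>i\<in>A. h i s) * ennreal (1 + drift s) + ennreal (p * \<beta> s) * ennreal (1 + drift s)"
      unfolding sum_distrib_right[symmetric] by (simp only: sum_ennreal[OF h_nonneg[OF _ s]])
    also have "\<dots> = ennreal (G s)"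
      unfolding G_def distrib_right[symmetric]
      by (simp only: ennreal_plus[OF sum_nonneg[OF h_nonneg[OF _ s]] p\<beta>_nonneg[OF s], symmetric]
          ennreal_mult'[OF add_nonneg_nonneg[OF sum_nonneg[OF h_nonneg[OF _ s]] p\<beta>_nonneg[OF s]], symmetric])
    finally show ?thesis .
  qed
  \<comment> \<open>A real-valued flux for the integral calculus. Since \<open>enn2real\<close> maps
    infinity to 0, it represents the flux only where the bound by \<open>G\<close> is available,
    that is for s >= 0.\<close>
  define f where "f s = enn2real (ennreal ?C * flux p s)" for s
  have ennreal_f: "ennreal (f s) = ennreal ?C * flux p s" if "0 \<le> s" for s
    unfolding f_def using flux_le_G[OF that] by (intro ennreal_enn2real) (auto intro: le_less_trans)
  have f_nonneg: "0 \<le> f s" for s by (simp add: f_def)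
  have f_le_G: "f s \<le> G s" if "0 \<le> s" for s
  proof -
    have "0 \<le> G s" unfolding G_def
      using drift_nonneg[OF that] by (intro mult_nonneg_nonneg add_nonneg_nonneg sum_nonneg h_nonneg that p\<beta>_nonneg) auto
    then show ?thesis using flux_le_G[OF that] unfolding ennreal_f[OF that, symmetric] by simp
  qed
  have [measurable]: "f \<in> borel_measurable borel" unfolding f_def[abs_def] by measurable
  have f_int: "f integrable_on {0..T}" for T
  proof -
    have "continuous_on {0..T} G"
      unfolding G_def[abs_def]
      by (intro continuous_intros continuous_on_subset[OF h_cont] continuous_on_subset[OF \<beta>_cont] continuous_on_subset[OF drift_cont]) auto
    then have "set_integrable lborel {0..T} G" by (rule borel_integrable_atLeastAtMost')
    then have "set_integrable lborel {0..T} f"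
      by (rule set_integrable_bound) (auto simp: set_borel_measurable_def f_nonneg intro!: AE_I2 order_trans[OF f_le_G])
    then show ?thesis by (rule set_borel_integral_eq_integral)
  qed
  \<comment> \<open>The majorant integrates the actual flux instead of being the moment itself: it
    is continuous by construction, so no regularity of the moments in time is needed.\<close>
  define n where "n t = x0 powr p + integral {0..t} f" for t
  have n_cont: "continuous_on {0..} n" unfolding n_def[abs_def] by (rule continuous_on_indefinite_integral[OF f_int])
  have int_f_nonneg: "0 \<le> integral {0..t} f" for t by (intro integral_nonneg f_int f_nonneg)
  have n_nonneg: "0 \<le> n t" for t unfolding n_def using int_f_nonneg[of t] by simp
  have mom_le_n: "mom t p \<le> ennreal (n t)" if t: "0 \<le> t" for t
  proof -
    have "(\<integral>\<^sup>+s\<in>{0..t}. ennreal ?C * flux p s \<partial>lborel) = (\<integral>\<^sup>+s\<in>{0..t}. ennreal (f s) \<partial>lborel)"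
      by (intro nn_integral_cong) (auto simp: ennreal_f split: split_indicator)
    also have "\<dots> = ennreal (integral {0..t} f)"
      by (intro nn_integral_has_integral_lebesgue' f_nonneg integrable_integral f_int)
    finally show ?thesis
      using mom_le_flux[OF t p] unfolding n_def by (simp add: ennreal_plus int_f_nonneg)
  qed
  \<comment> \<open>The loop closes here: the moments in the flux are estimated by powers of
    \<open>n\<close>, which dominates the p-th moment, and \<open>n\<close> is the integral of that
    same flux.\<close>
  have f_le_F: "f s \<le> F s (n s)" if s: "0 \<le> s" for s
  proof -
    have "ennreal (f s) \<le> (\<Sum>i\<in>A. ennreal (h i s) * ennreal (n s powr ((p + 1 - \<alpha> i) / p))) + ennreal (p * \<beta> s) * ennreal (n s powr ((p - 1) / p))"
      unfolding ennreal_f[OF s] Cflux[OF s] using exps p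
      by (intro add_mono sum_mono mult_left_mono mom_le_powr s n_nonneg mom_le_n) auto
    also have "\<dots> = (\<Sum>i\<in>A. ennreal (h i s * n s powr ((p + 1 - \<alpha> i) / p))) + ennreal (p * \<beta> s * n s powr ((p - 1) / p))"
      by (intro arg_cong2[where f = "(+)"] sum.cong refl ennreal_mult'[symmetric] h_nonneg p\<beta>_nonneg s)
    also have "\<dots> = ennreal ((\<Sum>i\<in>A. h i s * n s powr ((p + 1 - \<alpha> i) / p)) + p * \<beta> s * n s powr ((p - 1) / p))"
    proof -
      have "0 \<le> h i s * n s powr ((p + 1 - \<alpha> i) / p)" if "i \<in> A" for i using h_nonneg[OF that s] by simp
      moreover have "0 \<le> p * \<beta> s * n s powr ((p - 1) / p)" using p\<beta>_nonneg[OF s] by simp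
      ultimately show ?thesis by (simp only: sum_ennreal ennreal_plus sum_nonneg)
    qed
    also have "\<dots> = ennreal (F s (n s))" unfolding F_def by (simp only: add.commute)
    finally show ?thesis
      by (rule ennreal_le_iff[THEN iffD1, rotated])
        (auto simp: F_def intro!: add_nonneg_nonneg sum_nonneg mult_nonneg_nonneg h_nonneg s \<beta>_nonneg less_imp_le[OF p(1)[THEN order.strict_trans[OF zero_less_one]]])
  qed
  have F_cont: "continuous_on ({0..} \<times> {0..}) (\<lambda>(s, y). F s y)"
  proof -
    have fst: "continuous_on ({0..} \<times> {0..}) (\<lambda>x :: real \<times> real. u (fst x))"
      if "continuous_on {0..} u" for u :: "real \<Rightarrow> real"
      by (rule continuous_on_compose2[OF that]) (auto intro!: continuous_intros)
    \<comment> \<open>Continuity has to include the boundary y = 0, where the solution starts if x0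
      = 0.\<close>
    have pw: "continuous_on ({0..} \<times> {0..}) (\<lambda>x :: real \<times> real. snd x powr \<theta>)" if "0 < \<theta>" for \<theta>
      using that by (intro continuous_on_powr' continuous_intros) auto
    show ?thesis
      unfolding F_def case_prod_unfold using exp0 exps
      by (intro continuous_on_add continuous_on_mult continuous_on_sum continuous_on_const fst pw h_cont \<beta>_cont) auto
  qed
  have F_growth: "\<exists>K. \<forall>s\<in>{0..T}. \<forall>y\<ge>0. F s y \<le> K * (1 + y)" for T
  proof -
    have "continuous_on {0..T} (\<lambda>s. p * \<beta> s + (\<Sum>i\<in>A. h i s))"
      by (intro continuous_intros continuous_on_subset[OF h_cont] continuous_on_subset[OF \<beta>_cont]) auto
    then have "bounded ((\<lambda>s. p * \<beta> s + (\<Sum>i\<in>A. h i s)) ` {0..T})"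
      by (intro compact_imp_bounded compact_continuous_image) auto
    then obtain K where K: "\<And>s. s \<in> {0..T} \<Longrightarrow> p * \<beta> s + (\<Sum>i\<in>A. h i s) \<le> K"
      by (auto simp: bounded_iff) (meson abs_le_D1 atLeastAtMost_iff)
    have "F s y \<le> K * (1 + y)" if s: "s \<in> {0..T}" and y: "0 \<le> y" for s y
    proof -
      have s0: "0 \<le> s" using s by simp
      have "F s y \<le> p * \<beta> s * (1 + y) + (\<Sum>i\<in>A. h i s * (1 + y))"
        unfolding F_def using exp0 exps s0 y
        by (intro add_mono sum_mono mult_left_mono powr_le_one_plus h_nonneg p\<beta>_nonneg) (auto intro: less_imp_le)
      also have "\<dots> = (p * \<beta> s + (\<Sum>i\<in>A. h i s)) * (1 + y)" by (simp only: distrib_right sum_distrib_right)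
      also have "\<dots> \<le> K * (1 + y)" using K[OF s] y by (intro mult_right_mono) auto
      finally show ?thesis .
    qed
    then show ?thesis by blast
  qed
  obtain I where I: "I 0 = x0 powr p" "\<And>t. 0 \<le> t \<Longrightarrow> n t \<le> I t"
    "\<And>t. 0 \<le> t \<Longrightarrow> (I has_real_derivative F t (I t)) (at t within {0..})"
  proof (rule monotone_ode_solution_above_subsolution[of F n "x0 powr p"])
    show "continuous_on ({0..} \<times> {0..}) (\<lambda>(t, y). F t y)" by (rule F_cont)
    show "0 \<le> F t y" if "0 \<le> t" "0 \<le> y" for t y
      unfolding F_def by (intro add_nonneg_nonneg sum_nonneg mult_nonneg_nonneg[OF p\<beta>_nonneg] mult_nonneg_nonneg[OF h_nonneg] that) auto
    show "F t x \<le> F t y" if "0 \<le> t" "0 \<le> x" "x \<le> y" for t x y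
      unfolding F_def using that exp0 exps
      by (intro add_mono sum_mono mult_left_mono powr_mono2 h_nonneg p\<beta>_nonneg) (auto intro: less_imp_le)
    show "\<exists>K. \<forall>t\<in>{0..T}. \<forall>y\<ge>0. F t y \<le> K * (1 + y)" for T by (rule F_growth)
    show "continuous_on {0..} n" by (rule n_cont)
    show "n t \<le> x0 powr p + integral {0..t} (\<lambda>s. F s (n s))" if "0 \<le> t" for t
    proof -
      have "continuous_on {0..t} (\<lambda>s. (s, n s))"
        by (intro continuous_intros continuous_on_subset[OF n_cont]) auto
      moreover have "(\<lambda>s. (s, n s)) ` {0..t} \<subseteq> {0..} \<times> {0..}" using n_nonneg by auto
      ultimately have "continuous_on {0..t} (\<lambda>s. case (s, n s) of (s, y) \<Rightarrow> F s y)"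
        by (rule continuous_on_compose2[OF F_cont])
      then have "(\<lambda>s. F s (n s)) integrable_on {0..t}" by (intro integrable_continuous_real) simp
      then show ?thesis unfolding n_def[of t]
        by (intro add_left_mono integral_le f_int f_le_F) auto
    qed
  qed (auto simp: n_nonneg)
  show thesis
  proof (rule that[of I])
    show "I 0 = x0 powr p" by (rule I)
    show "0 \<le> I t" if "0 \<le> t" for t using I(2)[OF that] n_nonneg[of t] by linarith
    show "mom t p \<le> ennreal (I t)" if "0 \<le> t" for t
      using mom_le_n[OF that] ennreal_leI[OF I(2)[OF that]] by (rule order_trans)
    show "(I has_real_derivative p * \<beta> t * I t powr ((p - 1) / p)
      + (\<Sum>i\<in>A. ?C * Gamma (\<alpha> i - p) * k i t * I t powr ((p + 1 - \<alpha> i) / p))) (at t within {0..})" if "0 \<le> t" for t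
      using I(3)[OF that] unfolding F_def h_def .
  qed
qed

end

section \<open>The rescaled short rate\<close>

text \<open>If \<alpha> 1 = 2, the jump formula at i = 1 loses its Gamma factors, since Gamma (2 -
  p) cancels, and has exponent (p - 1) / p and discount exp (-a t): it is exactly the diffusion
  term. The sum over 1..g thus covers both cases.\<close>

lemma moment_ode_rhs_eq:
  assumes g: "g \<ge> 1" and p: "p < 2"
  shows "moment_ode_rhs g a b \<alpha> \<eta> p t y = p * (b * exp (- a * t)) * y powr ((p - 1) / p)
    + (\<Sum>i = 1..g. p * (p - 1) / Gamma (2 - p) * Gamma (\<alpha> i - p) * (\<eta> i * exp (a * (1 - \<alpha> i) * t)) * y powr ((p + 1 - \<alpha> i) / p))"
proof -
  define trm where "trm i = exp (a * (1 - \<alpha> i) * t) * (p * (p - 1) / Gamma (2 - p) * Gamma (\<alpha> i - p) * \<eta> i) * y powr ((p + 1 - \<alpha> i) / p)" for i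
  have "Gamma (2 - p) \<noteq> 0" using Gamma_real_pos[of "2 - p"] p by linarith
  then have first: "trm 1 = exp (- a * t) * (\<eta> 1 * (p - 1)) * p * y powr ((p - 1) / p)" if "\<alpha> 1 = 2"
    using that by (simp add: trm_def)
  have "(\<Sum>i = 1..g. trm i) = exp (- a * t) * (diffusion_coeff \<alpha> \<eta> * (p - 1)) * p * y powr ((p - 1) / p)
      + (\<Sum>i = first_jump_index \<alpha>..g. trm i)"
  proof (cases "\<alpha> 1 = 2")
    case True
    have "(\<Sum>i = 1..g. trm i) = trm 1 + (\<Sum>i = Suc 1..g. trm i)"
      by (rule sum.atLeast_Suc_atMost[OF g])
    then show ?thesis
      using True first by (simp add: diffusion_coeff_def first_jump_index_def numeral_2_eq_2)
  qed (simp add: diffusion_coeff_def first_jump_index_def)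
  moreover have "(\<Sum>i = 1..g. p * (p - 1) / Gamma (2 - p) * Gamma (\<alpha> i - p) * (\<eta> i * exp (a * (1 - \<alpha> i) * t)) * y powr ((p + 1 - \<alpha> i) / p))
    = (\<Sum>i = 1..g. trm i)"
    by (rule sum.cong) (simp_all only: trm_def mult_ac)
  ultimately show ?thesis
    unfolding moment_ode_rhs_def trm_def[symmetric] by (simp only: algebra_simps)
qed

text \<open>Discounting X means evaluating the Laplace transform of R along \<kappa> t = q exp (-a
  t). As \<kappa>' = -a \<kappa>, the chain rule contributes a \<kappa> times
  \<open>R.lap_mom\<close> and cancels the linear drift of the generator.\<close>

lemma rescaled_laplace_flow:
  assumes g: "g \<ge> 1" and b: "b \<ge> 0"
    and \<alpha>1: "\<alpha> 1 \<le> 2" and dec: "\<And>i j. 1 \<le> i \<Longrightarrow> i < j \<Longrightarrow> j \<le> g \<Longrightarrow> \<alpha> j < \<alpha> i" and \<alpha>g: "\<alpha> g > 1"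
    and \<eta>: "\<And>i. 1 \<le> i \<Longrightarrow> i \<le> g \<Longrightarrow> \<eta> i > 0" and r0: "r0 \<ge> 0"
    and inA: "class_A g a b \<alpha> \<eta> M R" and init: "AE \<omega> in M. R 0 \<omega> = r0"
  shows "laplace_flow M (\<lambda>t \<omega>. exp (- a * t) * R t \<omega>) {1..g} (\<lambda>i t. \<eta> i * exp (a * (1 - \<alpha> i) * t)) \<alpha> (\<lambda>t. b * exp (- a * t)) r0"
proof -
  from inA obtain P where mp: "nonneg_markov_process M R P"
    and gen: "has_generator_on affine_test_functions P (affine_generator g a b \<alpha> \<eta>)"
    by (auto simp: class_A_def)
  interpret prob_space M using mp by (simp add: nonneg_markov_process_def)
  have R_meas: "R t \<in> M \<rightarrow>\<^sub>M half_line" if "0 \<le> t" for t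
    using mp that by (simp add: nonneg_markov_process_def)
  interpret R: nonneg_family M R
  proof
    show "R t \<in> borel_measurable M" if "0 \<le> t" for t
      using R_meas[OF that] by (simp add: measurable_restrict_space2_iff)
    show "0 \<le> R t \<omega>" if "0 \<le> t" "\<omega> \<in> space M" for t \<omega>
      using measurable_space[OF R_meas[OF that(1)] that(2)] by (simp add: space_restrict_space)
  qed
  interpret X: nonneg_family M "\<lambda>t \<omega>. exp (- a * t) * R t \<omega>"
  proof
    show "(\<lambda>\<omega>. exp (- a * t) * R t \<omega>) \<in> borel_measurable M" if "0 \<le> t" for t
      by (intro borel_measurable_times borel_measurable_const R.X_measurable that)
    show "0 \<le> exp (- a * t) * R t \<omega>" if "0 \<le> t" "\<omega> \<in> space M" for t \<omega>
      using R.X_nonneg[OF that] by simp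
  qed
  define S where "S q = (\<Sum>i = 1..g. \<eta> i * q powr \<alpha> i)" for q
  have R_deriv: "((\<lambda>t. R.lap t q) has_real_derivative (S q - a * q) * R.lap_mom t q - b * q * R.lap t q) (at t within {0..})"
    if q: "0 < q" and t: "0 \<le> t" for q t
  proof -
    let ?f = "\<lambda>x. exp (- q * x)" and ?G = "\<lambda>x. exp (- q * x) * (x * (S q - a * q) - b * q)"
    have "?f \<in> affine_test_functions" using q unfolding affine_test_functions_def by blast
    then have lim: "uniform_limit {0..} (\<lambda>h x. ((\<integral>y. ?f y \<partial>P h x) - ?f x) / h) ?G (at_right 0)"
      using gen affine_generator_exp[where \<alpha> = \<alpha> and \<eta> = \<eta>, OF g \<alpha>1 dec \<alpha>g \<eta> q]
      unfolding has_generator_on_def S_def by (metis (no_types, lifting) ext)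
    have G_bdd: "\<bar>?G x\<bar> \<le> 1 / q * \<bar>S q - a * q\<bar> + \<bar>b * q\<bar>" if x: "0 \<le> x" for x
    proof -
      have "\<bar>?G x\<bar> = \<bar>x * exp (- q * x) * (S q - a * q) - exp (- q * x) * (b * q)\<bar>"
        by (simp add: algebra_simps)
      also have "\<dots> \<le> \<bar>x * exp (- q * x) * (S q - a * q)\<bar> + \<bar>exp (- q * x) * (b * q)\<bar>" by (rule abs_triangle_ineq4)
      also have "\<bar>x * exp (- q * x) * (S q - a * q)\<bar> \<le> 1 / q * \<bar>S q - a * q\<bar>"
        unfolding abs_mult[of _ "S q - a * q"] using mult_exp_neg_le[OF q, of x] x by (intro mult_right_mono) simp_all
      also have "\<bar>exp (- q * x) * (b * q)\<bar> \<le> 1 * \<bar>b * q\<bar>"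
        unfolding abs_mult[of _ "b * q"] using x q by (intro mult_right_mono) simp_all
      finally show ?thesis by simp
    qed
    have "((\<lambda>t. \<integral>\<omega>. ?f (R t \<omega>) \<partial>M) has_real_derivative (\<integral>\<omega>. ?G (R t \<omega>) \<partial>M)) (at t within {0..})"
    proof (rule nonneg_markov_process_generator_derivative[OF mp lim _ _ _ G_bdd t])
      show "?f \<in> borel_measurable half_line" "?G \<in> borel_measurable half_line"
        by (rule measurable_restrict_space1, measurable)+
      show "\<bar>?f x\<bar> \<le> 1" if "0 \<le> x" for x using that q by simp
    qed
    moreover have "has_bochner_integral M (\<lambda>\<omega>. (S q - a * q) * (R t \<omega> * exp (- q * R t \<omega>)) - b * q * exp (- q * R t \<omega>))
        ((S q - a * q) * R.lap_mom t q - b * q * R.lap t q)"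
      unfolding R.lap_def R.lap_mom_def using t q
      by (intro has_bochner_integral_diff has_bochner_integral_mult_right has_bochner_integral_integrable
          R.integrable_exp R.integrable_mult_exp) auto
    then have "(\<integral>\<omega>. ?G (R t \<omega>) \<partial>M) = (S q - a * q) * R.lap_mom t q - b * q * R.lap t q"
      by (simp add: has_bochner_integral_iff algebra_simps)
    ultimately show ?thesis by (simp only: R.lap_def)
  qed
  have R_mom_cont: "continuous_on {0..} (\<lambda>t. R.lap_mom t q)" if "0 < q" for q
    by (rule R.lap_mom_continuous)
      (auto simp: continuous_on_eq_continuous_within that intro: DERIV_continuous[OF R_deriv])
  have X_lap: "X.lap t q = R.lap t (q * exp (- a * t))" for t q
    unfolding X.lap_def R.lap_def by (simp add: mult.assoc)
  have X_mom: "X.lap_mom t q = exp (- a * t) * R.lap_mom t (q * exp (- a * t))" for t q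
    unfolding X.lap_mom_def R.lap_mom_def by (simp only: integral_mult_right_zero[symmetric]) (simp add: mult_ac)
  show ?thesis
  proof
    show "0 \<le> r0" by (rule r0)
    show "AE \<omega> in M. exp (- a * 0) * R 0 \<omega> = r0" using init by simp
    show "finite {1..g}" by simp
    show "continuous_on {0..} (\<lambda>t. \<eta> i * exp (a * (1 - \<alpha> i) * t))" for i by (intro continuous_intros)
    show "0 \<le> \<eta> i * exp (a * (1 - \<alpha> i) * t)" if "i \<in> {1..g}" for i t using \<eta>[of i] that by simp
    show "continuous_on {0..} (\<lambda>t. b * exp (- a * t))" by (intro continuous_intros)
    show "0 \<le> b * exp (- a * t)" for t using b by simp
    fix t q :: real assume t: "0 \<le> t" and q: "0 < q"
    let ?\<kappa> = "\<lambda>s. q * exp (- a * s)"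
    have pos: "0 < ?\<kappa> t" using q by simp
    have "((\<lambda>s. R.lap s (?\<kappa> s)) has_real_derivative
      ((S (?\<kappa> t) - a * ?\<kappa> t) * R.lap_mom t (?\<kappa> t) - b * ?\<kappa> t * R.lap t (?\<kappa> t)) - (- a * ?\<kappa> t) * R.lap_mom t (?\<kappa> t)) (at t within {0..})"
    proof (rule R.lap_chain_rule[where \<kappa> = ?\<kappa>, OF t R_deriv[OF pos t] _ pos])
      show "(?\<kappa> has_real_derivative - a * ?\<kappa> t) (at t within {0..})"
        by (auto intro!: derivative_eq_intros)
      show "continuous (at t within {0..}) (\<lambda>s. R.lap_mom s (?\<kappa> t))"
        using R_mom_cont[OF pos] t by (simp add: continuous_on_eq_continuous_within)
    qed
    also have "((S (?\<kappa> t) - a * ?\<kappa> t) * R.lap_mom t (?\<kappa> t) - b * ?\<kappa> t * R.lap t (?\<kappa> t)) - (- a * ?\<kappa> t) * R.lap_mom t (?\<kappa> t)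
      = S (?\<kappa> t) * R.lap_mom t (?\<kappa> t) - b * exp (- a * t) * q * X.lap t q"
      by (simp only: X_lap) (simp add: algebra_simps)
    \<comment> \<open>From (q exp (-a t))^(\<alpha> i) one factor exp (-a t) is split off, because
      it converts \<open>R.lap_mom\<close> into \<open>X.lap_mom\<close>; the rest is the discount
      exp (a (1 - \<alpha> i) t).\<close>
    also have "S (?\<kappa> t) = (\<Sum>i = 1..g. \<eta> i * exp (a * (1 - \<alpha> i) * t) * q powr \<alpha> i) * exp (- a * t)"
      unfolding S_def sum_distrib_right
    proof (intro sum.cong refl)
      fix i
      have "(q * exp (- a * t)) powr \<alpha> i = q powr \<alpha> i * exp (- a * t * \<alpha> i)"
        using q by (simp add: powr_mult exp_powr_real)
      moreover have "exp (- a * t * \<alpha> i) = exp (a * (1 - \<alpha> i) * t) * exp (- a * t)"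
        by (simp add: algebra_simps flip: exp_add)
      ultimately show "\<eta> i * (q * exp (- a * t)) powr \<alpha> i = \<eta> i * exp (a * (1 - \<alpha> i) * t) * q powr \<alpha> i * exp (- a * t)"
        by simp
    qed
    finally show "((\<lambda>t. X.lap t q) has_real_derivative
      (\<Sum>i = 1..g. \<eta> i * exp (a * (1 - \<alpha> i) * t) * q powr \<alpha> i) * X.lap_mom t q - b * exp (- a * t) * q * X.lap t q) (at t within {0..})"
      by (simp only: X_lap[symmetric] X_mom mult.assoc)
  qed
qed

theorem proposition3p6:
  fixes M :: "'w measure" and R :: "real \<Rightarrow> 'w \<Rightarrow> real"
    and g :: nat and a b r\<^sub>0 :: real and \<alpha> \<eta> :: "nat \<Rightarrow> real"
  assumes "g \<ge> 1" and "b \<ge> 0"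
    and "\<alpha> 1 \<le> 2" and "\<And>i j. 1 \<le> i \<Longrightarrow> i < j \<Longrightarrow> j \<le> g \<Longrightarrow> \<alpha> j < \<alpha> i" and "\<alpha> g > 1"
    and "\<And>i. 1 \<le> i \<Longrightarrow> i \<le> g \<Longrightarrow> \<eta> i > 0"
    and "r\<^sub>0 \<ge> 0"
    and "class_A g a b \<alpha> \<eta> M R"
    and "AE \<omega> in M. R 0 \<omega> = r\<^sub>0"
  shows "(\<forall>p. 0 < p \<and> p < \<alpha> g \<longrightarrow> (\<forall>t>0. integrable M (\<lambda>\<omega>. R t \<omega> powr p))) \<and>
    (\<forall>p. 1 < p \<and> p < \<alpha> g \<longrightarrow>
       (\<exists>I :: real \<Rightarrow> real.
          (\<forall>t\<ge>0. I t \<ge> 0) \<and>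
          I 0 = r\<^sub>0 powr p \<and>
          (\<forall>t\<ge>0. (I has_real_derivative moment_ode_rhs g a b \<alpha> \<eta> p t (I t)) (at t within {0..})) \<and>
          (\<forall>t\<ge>0. (\<integral>\<omega>. R t \<omega> powr p \<partial>M) \<le> exp (a * p * t) * I t)))"
proof -
  let ?X = "\<lambda>t \<omega>. exp (- a * t) * R t \<omega>"
  interpret X: laplace_flow M ?X "{1..g}" "\<lambda>i t. \<eta> i * exp (a * (1 - \<alpha> i) * t)" \<alpha> "\<lambda>t. b * exp (- a * t)" r\<^sub>0
    by (rule rescaled_laplace_flow) (use assms in auto)
  have range: "\<alpha> g \<le> \<alpha> i" "\<alpha> i \<le> 2" if "i \<in> {1..g}" for i
    using that assms(3) assms(4)[of i g] assms(4)[of 1 i] by (cases "i = g"; cases "i = 1"; force)+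
  have R_eq: "R t \<omega> = exp (a * t) * ?X t \<omega>" for t \<omega>
    by (simp flip: mult.assoc exp_add)
  have R_nonneg: "0 \<le> R t \<omega>" if "0 \<le> t" "\<omega> \<in> space M" for t \<omega>
    using X.X_nonneg[OF that] by (simp add: zero_le_mult_iff)
  have R_meas: "R t \<in> borel_measurable M" if "0 \<le> t" for t
  proof -
    have "(\<lambda>\<omega>. exp (a * t) * ?X t \<omega>) \<in> borel_measurable M"
      by (intro borel_measurable_times borel_measurable_const X.X_measurable that)
    then show ?thesis by (simp flip: mult.assoc exp_add)
  qed
  have main: "\<exists>I. (\<forall>t\<ge>0. I t \<ge> 0) \<and> I 0 = r\<^sub>0 powr p \<and>
      (\<forall>t\<ge>0. (I has_real_derivative moment_ode_rhs g a b \<alpha> \<eta> p t (I t)) (at t within {0..})) \<and>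
      (\<forall>t\<ge>0. integrable M (\<lambda>\<omega>. R t \<omega> powr p) \<and> (\<integral>\<omega>. R t \<omega> powr p \<partial>M) \<le> exp (a * p * t) * I t)"
    if p: "1 < p" "p < \<alpha> g" for p
  proof -
    have p2: "p < 2" using p range[of g] assms(1) by auto
    have \<alpha>: "p < \<alpha> i \<and> \<alpha> i \<le> 2" if "i \<in> {1..g}" for i using p range[OF that] by auto
    obtain I where I: "I 0 = r\<^sub>0 powr p" "\<And>t. 0 \<le> t \<Longrightarrow> 0 \<le> I t"
      "\<And>t. 0 \<le> t \<Longrightarrow> (I has_real_derivative moment_ode_rhs g a b \<alpha> \<eta> p t (I t)) (at t within {0..})"
      "\<And>t. 0 \<le> t \<Longrightarrow> X.mom t p \<le> ennreal (I t)"
      using X.moment_ode_solution[OF p(1) p2 \<alpha>] unfolding moment_ode_rhs_eq[OF assms(1) p2] by blast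
    have "integrable M (\<lambda>\<omega>. R t \<omega> powr p) \<and> (\<integral>\<omega>. R t \<omega> powr p \<partial>M) \<le> exp (a * p * t) * I t" if t: "0 \<le> t" for t
    proof -
      have Rp: "R t \<omega> powr p = exp (a * p * t) * ?X t \<omega> powr p" if "\<omega> \<in> space M" for \<omega>
        using X.X_nonneg[OF t that] by (subst R_eq, subst powr_mult) (simp_all add: exp_powr_real mult_ac)
      have int: "integrable M (\<lambda>\<omega>. ?X t \<omega> powr p)"
        using X.X_measurable[OF t] I(4)[OF t, unfolded X.mom_def]
        by (intro integrableI_nonneg) (auto intro: le_less_trans)
      have "(\<integral>\<omega>. ?X t \<omega> powr p \<partial>M) \<le> I t"
        using I(4)[OF t] I(2)[OF t] unfolding X.mom_def
        by (subst (asm) nn_integral_eq_integral[OF int]) auto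
      then have "exp (a * p * t) * (\<integral>\<omega>. ?X t \<omega> powr p \<partial>M) \<le> exp (a * p * t) * I t" by simp
      moreover have "integrable M (\<lambda>\<omega>. R t \<omega> powr p) \<longleftrightarrow> integrable M (\<lambda>\<omega>. exp (a * p * t) * ?X t \<omega> powr p)"
        by (intro Bochner_Integration.integrable_cong refl Rp)
      moreover have "(\<integral>\<omega>. R t \<omega> powr p \<partial>M) = (\<integral>\<omega>. exp (a * p * t) * ?X t \<omega> powr p \<partial>M)"
        by (intro Bochner_Integration.integral_cong refl Rp)
      ultimately show ?thesis using int by simp
    qed
    with I show ?thesis by blast
  qed
  have integrable_powr: "integrable M (\<lambda>\<omega>. R t \<omega> powr p)" if p: "0 < p" "p < \<alpha> g" and t: "0 < t" for p t
  proof -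
    \<comment> \<open>Orders p <= 1 are outside the range of the main estimate. The midpoint r lies
      in (1, \<alpha> g) and above p, and x^p = (x^r)^(p/r) is at most 1 + x^r.\<close>
    define r where "r = (max 1 p + \<alpha> g) / 2"
    have r: "1 < r" "r < \<alpha> g" "p < r" using p assms(5) by (auto simp: r_def)
    have int: "integrable M (\<lambda>\<omega>. R t \<omega> powr r)" using main[OF r(1,2)] less_imp_le[OF t] by blast
    show ?thesis
    proof (rule Bochner_Integration.integrable_bound)
      show "integrable M (\<lambda>\<omega>. 1 + R t \<omega> powr r)" by (intro Bochner_Integration.integrable_add int X.integrable_const)
      show "(\<lambda>\<omega>. R t \<omega> powr p) \<in> borel_measurable M" using R_meas[of t] t by simp
      show "AE \<omega> in M. norm (R t \<omega> powr p) \<le> norm (1 + R t \<omega> powr r)"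
      proof (rule AE_I2)
        fix \<omega>
        have "(R t \<omega> powr r) powr (p / r) \<le> 1 + R t \<omega> powr r"
          using p r by (intro powr_le_one_plus) auto
        then show "norm (R t \<omega> powr p) \<le> norm (1 + R t \<omega> powr r)" using r by (simp add: powr_powr)
      qed
    qed
  qed
  show ?thesis
  proof (intro conjI allI impI)
    fix p t :: real assume "0 < p \<and> p < \<alpha> g" "0 < t"
    then show "integrable M (\<lambda>\<omega>. R t \<omega> powr p)" by (intro integrable_powr) auto
  next
    fix p assume "1 < p \<and> p < \<alpha> g"
    then have p: "1 < p" "p < \<alpha> g" by auto
    show "\<exists>I. (\<forall>t\<ge>0. I t \<ge> 0) \<and> I 0 = r\<^sub>0 powr p \<and>
      (\<forall>t\<ge>0. (I has_real_derivative moment_ode_rhs g a b \<alpha> \<eta> p t (I t)) (at t within {0..})) \<and>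
      (\<forall>t\<ge>0. (\<integral>\<omega>. R t \<omega> powr p \<partial>M) \<le> exp (a * p * t) * I t)"
      using main[OF p]
    proof (rule ex_forward, elim conjE)
      fix I :: "real \<Rightarrow> real"
      assume 1: "\<forall>t\<ge>0. I t \<ge> 0" and 2: "I 0 = r\<^sub>0 powr p"
        and 3: "\<forall>t\<ge>0. (I has_real_derivative moment_ode_rhs g a b \<alpha> \<eta> p t (I t)) (at t within {0..})"
        and 4: "\<forall>t\<ge>0. integrable M (\<lambda>\<omega>. R t \<omega> powr p) \<and> (\<integral>\<omega>. R t \<omega> powr p \<partial>M) \<le> exp (a * p * t) * I t"
      from 4 have 4: "\<forall>t\<ge>0. (\<integral>\<omega>. R t \<omega> powr p \<partial>M) \<le> exp (a * p * t) * I t" by simp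
      show "(\<forall>t\<ge>0. I t \<ge> 0) \<and> I 0 = r\<^sub>0 powr p \<and>
        (\<forall>t\<ge>0. (I has_real_derivative moment_ode_rhs g a b \<alpha> \<eta> p t (I t)) (at t within {0..})) \<and>
        (\<forall>t\<ge>0. (\<integral>\<omega>. R t \<omega> powr p \<partial>M) \<le> exp (a * p * t) * I t)"
        by (rule conjI[OF 1 conjI[OF 2 conjI[OF 3 4]]])
    qed
  qed
qed

end
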